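(* Let $F,G,H$ be functions as in the context and assume: (FGH1) $F\big(\frac{H(s)+\epsilon}{G^{-1}(1)}\big)<\infty$ for some $s\in\mathbb{R}$ and $\epsilon>0$; (FGH2) $\lim_{s\to\infty}\big(F(H(s))-G^{-1}(1)\,s\big)=\infty$. Let $T$ be the associated transformed norm risk measure on $\mathcal{X}$, and let $\overline{T}(X)=\sup_{\pi\in\Pi}T(\mathbb{E}[X|\pi])$ for $X\in L^1$. Then $$\overline{T}(X)=\sup_{\frac{d\mathbb{Q}}{d\mathbb{P}}\in\mathcal{L}}\Big\{\mathbb{E}_{\mathbb{Q}}[-X]-T^{\#}\Big(-\frac{d\mathbb{Q}}{d\mathbb{P}}\Big)\Big\}\qquad\text{for all }X\in L^1,$$ where the supremum is over all probability measures $\mathbb{Q}$ absolutely continuous with respect to $\mathbb{P}$ whose density $\frac{d\mathbb{Q}}{d\mathbb{P}}$ belongs to $\mathcal{L}$, $T^{\#}(Y)=\sup_{X\in\mathcal{L}}\{\mathbb{E}[XY]-T(X)\}$ for $Y\in L^1$, and for each such $\mathbb{Q}$ $$T^{\#}\Big(-\frac{d\mathbb{Q}}{d\mathbb{P}}\Big)=\min_{\eta\in L^{G^*}_+,\ \{\eta=0\}\subset\{\frac{d\mathbb{Q}}{d\mathbb{P}}=0\}}\Big\{\mathbb{E}\Big[\eta\, H^*\Big(\frac1\eta\frac{d\mathbb{Q}}{d\mathbb{P}}\mathbb{1}_{\{\frac{d\mathbb{Q}}{d\mathbb{P}}>0\}}\Big)\Big]+F^*(\|\eta\|_G^* )\B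ig\}.$$
   Context: $(\Omega,\mathcal{F},\mathbb{P})$ is a fixed nonatomic probability space; $L^1$ is the space of integrable random variables modulo a.s. equality; relations between random variables and events are up to null sets. $\mathcal{L}$ is the space of simple random variables $\sum_{i=1}^n a_i\mathbb{1}_{A_i}$ ($n\in\mathbb{N}$, $a_i\in\mathbb{R}$, $A_i\in\mathcal{F}$). $\Pi$ is the collection of all finite measurable partitions of $\Omega$ whose members have nonzero probability, and $\mathbb{E}[X|\pi]:=\mathbb{E}[X|\sigma(\pi)]$, where $\sigma(\pi)$ is the $\sigma$-algebra generated by $\pi$. An Orlicz function is a left-continuous convex $G:[0,\infty)\to[0,\infty]$ with $\lim_{x\to0^+}G(x)=G(0)=0$ and $\lim_{x\to\infty}G(x)=\infty$; its convex conjugate $G^*(y)=\sup_{x\ge0}\{xy-G(x)\}$, $y\ge0$, is again an Orlicz function. The Luxemburg norm is $\|X\|_G=\inf\{\lambda>0:\mathbb{E}[G(|X|/\lambda)]\le1\}$ ($=\infty$ if no such $\lambda$ exists), the Orlicz space is $L^G=\{X\in L^1:\mathbb{E}[G(c|X|)]<\infty\text{ for some }c>0\}=\{X\in L^1:\|X\|_G<\infty\}$, and $L^{G^*}_+$ is the set of nonnegative elements of $L^{G^*}$. The Orlicz norm is $\|X\|_G^*=\sup\{\mathbb{E}[XY]:\|Y\|_G\le1\}$. $G^{-1}(1):=\sup\{t>0:G(t)\le1\}$. "Increasing" means $x\le y\Rightarrow V(x)\le V(y)$. Standing assumptions: $F:[0,\infty)\to(-\infty,\infty]$ is left-continuous,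 increasing, convex, not identically $\infty$, with $\lim_{x\to\infty}F(x)=\infty$; $G$ is a real-valued Orlicz function; $H:\mathbb{R}\to[0,\infty)$ is increasing and convex with $\lim_{x\to\infty}H(x)=\infty$. Convex conjugates: $F^*(y)=\sup_{x\ge0}\{xy-F(x)\}$, $H^*(y)=\sup_{x\in\mathbb{R}}\{xy-H(x)\}$. The expression $\frac1\eta\frac{d\mathbb{Q}}{d\mathbb{P}}\mathbb{1}_{\{\frac{d\mathbb{Q}}{d\mathbb{P}}>0\}}$ is understood to be $0$ on $\{\frac{d\mathbb{Q}}{d\mathbb{P}}=0\}$ (in particular where $\eta=0$). $\mathcal{X}=\{X\in L^1:H(s-X)\in L^G\text{ for all }s\in\mathbb{R}\}$ (it contains $L^\infty$), and $T(X)=\inf_{s\in\mathbb{R}}\{F(\|H(s-X)\|_G)-s\}$ for $X\in\mathcal{X}$. *)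

theory Defs
  imports "HOL-Probability.Probability"
begin

section \<open>Random variables\<close>

definition nonatomic :: "'a measure \<Rightarrow> bool" where
  "nonatomic M \<longleftrightarrow>
     (\<forall>A\<in>sets M. 0 < emeasure M A \<longrightarrow>
        (\<exists>B\<in>sets M. B \<subseteq> A \<and> 0 < emeasure M B \<and> emeasure M B < emeasure M A))"

text \<open>Random variables are represented by functions rather than by classes modulo null sets.
  Hence the closure under almost sure equality below; it matters for densities, which the
  Radon-Nikodym theorem determines only up to null sets.\<close>

definition simple_rvs :: "'a measure \<Rightarrow> ('a \<Rightarrow> real) set" where
  "simple_rvs M =
     {X \<in> borel_measurable M. \<exists>Z. simple_function M Z \<and> (AE \<omega> in M. X \<omega> = Z \<omega>)}"

definition finite_partitions :: "'a measure \<Rightarrow> 'a set set set" where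
  "finite_partitions M =
     {\<pi>. finite \<pi> \<and> partition_on (space M) \<pi> \<and> (\<forall>A\<in>\<pi>. A \<in> sets M \<and> emeasure M A \<noteq> 0)}"

definition partition_cond_exp :: "'a measure \<Rightarrow> 'a set set \<Rightarrow> ('a \<Rightarrow> real) \<Rightarrow> 'a \<Rightarrow> real" where
  "partition_cond_exp M \<pi> X = real_cond_exp M (sigma (space M) \<pi>) X"

text \<open>Expectation of an extended-real random variable. It is the usual value whenever the
  positive or the negative part has finite expectation; otherwise it is \<open>\<infinity>\<close>,
  because \<open>\<infinity> - \<infinity> = \<infinity>\<close> in \<^typ>\<open>ereal\<close>.\<close>

definition ereal_expectation :: "'a measure \<Rightarrow> ('a \<Rightarrow> ereal) \<Rightarrow> ereal" where
  "ereal_expectation M f =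
     enn2ereal (\<integral>\<^sup>+ \<omega>. e2ennreal (f \<omega>) \<partial>M) - enn2ereal (\<integral>\<^sup>+ \<omega>. e2ennreal (- f \<omega>) \<partial>M)"

definition rv_density :: "'a measure \<Rightarrow> 'a measure \<Rightarrow> 'a \<Rightarrow> real" where
  "rv_density M Q = (\<lambda>\<omega>. enn2real (RN_deriv M Q \<omega>))"

definition simple_density_measures :: "'a measure \<Rightarrow> 'a measure set" where
  "simple_density_measures M =
     {Q. sets Q = sets M \<and> prob_space Q \<and> absolutely_continuous M Q \<and> rv_density M Q \<in> simple_rvs M}"


section \<open>Convex functions and Orlicz spaces\<close>

text \<open>Functions on \<open>[0,\<infinity>)\<close> are rendered as functions on \<^typ>\<open>real\<close> of which only the values at
  nonnegative arguments are ever used.\<close>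

definition ereal_convex_on :: "real set \<Rightarrow> (real \<Rightarrow> ereal) \<Rightarrow> bool" where
  "ereal_convex_on D f \<longleftrightarrow>
     (\<forall>x\<in>D. \<forall>y\<in>D. \<forall>t\<in>{0..1}. f ((1 - t) * x + t * y) \<le> ereal (1 - t) * f x + ereal t * f y)"

definition left_continuous_pos :: "(real \<Rightarrow> ereal) \<Rightarrow> bool" where
  "left_continuous_pos f \<longleftrightarrow> (\<forall>x>0. (f \<longlongrightarrow> f x) (at_left x))"

definition orlicz_function :: "(real \<Rightarrow> ereal) \<Rightarrow> bool" where
  "orlicz_function G \<longleftrightarrow>
     (\<forall>x\<ge>0. 0 \<le> G x) \<and> left_continuous_pos G \<and> ereal_convex_on {0..} G \<and>
     G 0 = 0 \<and> (G \<longlongrightarrow> 0) (at_right 0) \<and> (G \<longlongrightarrow> \<infinity>) at_top"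

definition convex_conjugate_on :: "real set \<Rightarrow> (real \<Rightarrow> ereal) \<Rightarrow> real \<Rightarrow> ereal" where
  "convex_conjugate_on D f y = (SUP x\<in>D. ereal (x * y) - f x)"

definition inverse_at_one :: "(real \<Rightarrow> ereal) \<Rightarrow> real" where
  "inverse_at_one G = Sup {t. 0 < t \<and> G t \<le> 1}"

definition luxemburg_norm :: "'a measure \<Rightarrow> (real \<Rightarrow> ereal) \<Rightarrow> ('a \<Rightarrow> real) \<Rightarrow> ereal" where
  "luxemburg_norm M G X =
     Inf {ereal c | c. 0 < c \<and> (\<integral>\<^sup>+ \<omega>. e2ennreal (G (\<bar>X \<omega>\<bar> / c)) \<partial>M) \<le> 1}"

definition orlicz_space :: "'a measure \<Rightarrow> (real \<Rightarrow> ereal) \<Rightarrow> ('a \<Rightarrow> real) set" where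
  "orlicz_space M G =
     {X. integrable M X \<and> (\<exists>c>0. (\<integral>\<^sup>+ \<omega>. e2ennreal (G (c * \<bar>X \<omega>\<bar>)) \<partial>M) < \<infinity>)}"

definition orlicz_norm :: "'a measure \<Rightarrow> (real \<Rightarrow> ereal) \<Rightarrow> ('a \<Rightarrow> real) \<Rightarrow> ereal" where
  "orlicz_norm M G X =
     (SUP Y \<in> {Y. integrable M Y \<and> luxemburg_norm M G Y \<le> 1}.
        ereal_expectation M (\<lambda>\<omega>. ereal (X \<omega> * Y \<omega>)))"


section \<open>Transformed norm risk measures\<close>

definition tnrm_domain ::
  "'a measure \<Rightarrow> (real \<Rightarrow> ereal) \<Rightarrow> (real \<Rightarrow> real) \<Rightarrow> ('a \<Rightarrow> real) set" where
  "tnrm_domain M G H =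
     {X. integrable M X \<and> (\<forall>s. (\<lambda>\<omega>. H (s - X \<omega>)) \<in> orlicz_space M G)}"

text \<open>Meaningful on \<open>tnrm_domain M G H\<close> only, where the Luxemburg norm below is finite.\<close>

definition tnrm ::
  "'a measure \<Rightarrow> (real \<Rightarrow> ereal) \<Rightarrow> (real \<Rightarrow> ereal) \<Rightarrow> (real \<Rightarrow> real) \<Rightarrow> ('a \<Rightarrow> real) \<Rightarrow> ereal" where
  "tnrm M F G H X =
     (INF s. F (real_of_ereal (luxemburg_norm M G (\<lambda>\<omega>. H (s - X \<omega>)))) - ereal s)"

definition partition_extension ::
  "'a measure \<Rightarrow> (('a \<Rightarrow> real) \<Rightarrow> ereal) \<Rightarrow> ('a \<Rightarrow> real) \<Rightarrow> ereal" where
  "partition_extension M T X = (SUP \<pi>\<in>finite_partitions M. T (partition_cond_exp M \<pi> X))"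

definition simple_conjugate ::
  "'a measure \<Rightarrow> (('a \<Rightarrow> real) \<Rightarrow> ereal) \<Rightarrow> ('a \<Rightarrow> real) \<Rightarrow> ereal" where
  "simple_conjugate M T Y = (SUP X\<in>simple_rvs M. ereal (\<integral>\<omega>. X \<omega> * Y \<omega> \<partial>M) - T X)"

definition dual_multipliers ::
  "'a measure \<Rightarrow> (real \<Rightarrow> ereal) \<Rightarrow> ('a \<Rightarrow> real) \<Rightarrow> ('a \<Rightarrow> real) set" where
  "dual_multipliers M G Z =
     {\<eta> \<in> orlicz_space M (convex_conjugate_on {0..} G).
        (AE \<omega> in M. 0 \<le> \<eta> \<omega>) \<and> (AE \<omega> in M. \<eta> \<omega> = 0 \<longrightarrow> Z \<omega> = 0)}"

text \<open>The convention \<open>1 / 0 = 0\<close> agrees with the reading of the argument of \<open>H\<^sup>*\<close> as \<open>0\<close>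
  where \<open>Z\<close> vanishes. The Orlicz norm is finite for every \<open>\<eta>\<close> in the dual Orlicz space.\<close>

definition dual_penalty ::
  "'a measure \<Rightarrow> (real \<Rightarrow> ereal) \<Rightarrow> (real \<Rightarrow> ereal) \<Rightarrow> (real \<Rightarrow> real) \<Rightarrow>
     ('a \<Rightarrow> real) \<Rightarrow> ('a \<Rightarrow> real) \<Rightarrow> ereal" where
  "dual_penalty M F G H Z \<eta> =
     ereal_expectation M (\<lambda>\<omega>. ereal (\<eta> \<omega>) *
        convex_conjugate_on UNIV (\<lambda>x. ereal (H x)) (1 / \<eta> \<omega> * Z \<omega> * indicator {\<omega>. 0 < Z \<omega>} \<omega>))
     + convex_conjugate_on {0..} F (real_of_ereal (orlicz_norm M G \<eta>))"


section \<open>The risk measure is only evaluated on its domain\<close>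

lemma simple_rvs_subset_tnrm_domain:
  assumes "prob_space M"
    and "orlicz_function G" and Gfin: "\<forall>x\<ge>0. G x < \<infinity>"
    and "mono H"
  shows "simple_rvs M \<subseteq> tnrm_domain M G H"
proof
  interpret prob_space M by fact
  fix X assume "X \<in> simple_rvs M"
  then obtain Z where [measurable]: "X \<in> borel_measurable M"
    and Z: "simple_function M Z" and XZ: "AE \<omega> in M. X \<omega> = Z \<omega>"
    by (auto simp: simple_rvs_def)
  have [measurable]: "H \<in> borel_measurable borel"
    using \<open>mono H\<close> by (rule borel_measurable_mono)
  have int: "integrable M (\<lambda>\<omega>. f (X \<omega>))" if [measurable]: "f \<in> borel_measurable borel" for f :: "real \<Rightarrow> real"
  proof -
    let ?B = "Max ((\<lambda>z. norm (f z)) ` Z ` space M)"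
    have fin: "finite ((\<lambda>z. norm (f z)) ` Z ` space M)" using Z by (simp add: simple_functionD)
    have "AE \<omega> in M. norm (f (X \<omega>)) \<le> ?B"
      using XZ AE_space
    proof eventually_elim
      case (elim \<omega>)
      then show ?case by (intro Max_ge[OF fin]) auto
    qed
    then show ?thesis by (intro integrable_const_bound[where B = ?B]) auto
  qed
  have "(\<lambda>\<omega>. H (s - X \<omega>)) \<in> orlicz_space M G" for s
  proof -
    let ?f = "\<lambda>z. G (1 * \<bar>H (s - z)\<bar>)"
    have fin: "finite (?f ` Z ` space M)" using Z by (simp add: simple_functionD)
    have ne: "?f ` Z ` space M \<noteq> {}" using not_empty by auto
    let ?B = "Max (?f ` Z ` space M)"
    have "?B \<in> ?f ` Z ` space M" using Max_in[OF fin ne] .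
    then have B: "?B < \<infinity>" using Gfin by fastforce
    have "AE \<omega> in M. e2ennreal (?f (X \<omega>)) \<le> e2ennreal ?B"
      using XZ AE_space
    proof eventually_elim
      case (elim \<omega>)
      then show ?case by (intro e2ennreal_mono Max_ge[OF fin]) auto
    qed
    then have "(\<integral>\<^sup>+ \<omega>. e2ennreal (?f (X \<omega>)) \<partial>M) \<le> (\<integral>\<^sup>+ \<omega>. e2ennreal ?B \<partial>M)"
      by (rule nn_integral_mono_AE)
    also have "\<dots> = e2ennreal ?B" by (simp add: emeasure_space_1)
    also have "\<dots> < \<infinity>" using B by (cases ?B) (auto simp: e2ennreal_neg)
    finally show ?thesis
      using int[of "\<lambda>x. H (s - x)"] by (auto simp: orlicz_space_def intro!: exI[of _ 1])
  qed
  then show "X \<in> tnrm_domain M G H"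
    using int[of "\<lambda>x. x"] by (auto simp: tnrm_domain_def)
qed

lemma partition_cond_exp_simple:
  assumes \<pi>: "\<pi> \<in> finite_partitions M"
  shows "partition_cond_exp M \<pi> X \<in> simple_rvs M"
proof -
  let ?N = "sigma (space M) \<pi>" and ?Y = "partition_cond_exp M \<pi> X"
  have sub: "\<pi> \<subseteq> sets M" and fin: "finite \<pi>" and part: "partition_on (space M) \<pi>"
    using \<pi> by (auto simp: finite_partitions_def)
  have Pow: "\<pi> \<subseteq> Pow (space M)" using sub sets.sets_into_space by auto
  have setsN: "sets ?N = sigma_sets (space M) \<pi>" using Pow by (rule sets_measure_of)
  have spN: "space ?N = space M" using Pow by (rule space_measure_of)
  have subN: "sets ?N \<subseteq> sets M" unfolding setsN using sub by (rule sets.sigma_sets_subset)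
  have Y: "?Y \<in> borel_measurable ?N"
    unfolding partition_cond_exp_def by (rule borel_measurable_cond_exp)
  have YM: "?Y \<in> borel_measurable M"
    using Y subN spN by (auto simp: measurable_def)
  have atom: "A \<inter> S = {} \<or> A \<subseteq> S" if "S \<in> sigma_sets (space M) \<pi>" "A \<in> \<pi>" for S A
    using that(1)
  proof induction
    case (Basic B)
    then show ?case using part \<open>A \<in> \<pi>\<close> by (auto simp: partition_on_def disjoint_def)
  next
    case (Compl B)
    then show ?case using Pow \<open>A \<in> \<pi>\<close> by blast
  qed auto
  have const: "?Y x = ?Y y" if "A \<in> \<pi>" "x \<in> A" "y \<in> A" for A x y
  proof -
    have "?Y -` {?Y x} \<inter> space ?N \<in> sets ?N" using Y by (rule measurable_sets) simp
    then have "A \<subseteq> ?Y -` {?Y x} \<inter> space M \<or> A \<inter> (?Y -` {?Y x} \<inter> space M) = {}"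
      using atom[OF _ \<open>A \<in> \<pi>\<close>] by (auto simp: setsN spN)
    then show ?thesis using that Pow by auto
  qed
  have "?Y ` space M \<subseteq> (\<lambda>A. ?Y (SOME x. x \<in> A)) ` \<pi>"
  proof
    fix y assume "y \<in> ?Y ` space M"
    then obtain x where "y = ?Y x" "x \<in> \<Union>\<pi>"
      using partition_onD1[OF part] by auto
    then obtain A where "y = ?Y x" "A \<in> \<pi>" "x \<in> A" by auto
    have "(SOME x. x \<in> A) \<in> A" using \<open>x \<in> A\<close> by (rule someI)
    then have "y = ?Y (SOME x. x \<in> A)"
      using const[OF \<open>A \<in> \<pi>\<close> \<open>x \<in> A\<close>] \<open>y = ?Y x\<close> by simp
    then show "y \<in> (\<lambda>A. ?Y (SOME x. x \<in> A)) ` \<pi>"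
      using \<open>A \<in> \<pi>\<close> by (rule image_eqI)
  qed
  then have "finite (?Y ` space M)" using fin by (meson finite_imageI finite_subset)
  then have "simple_function M ?Y" using YM by (simp add: simple_function_borel_measurable)
  then show ?thesis using YM by (auto simp: simple_rvs_def)
qed

end

theory Submission
  imports Defs
begin

text \<open>Substituting \<open>U = s - X\<close> and using \<open>E[Z] = 1\<close>, the penalty of a density \<open>Z\<close> becomes
  \<open>sup\<^sub>U E[U Z] - F(\<parallel>H(U)\<parallel>)\<close>. The Young and Hoelder inequalities bound it by the dual objective of
  every multiplier \<open>\<eta>\<close>. Conversely, a simple \<open>Z\<close> is constant on the blocks of a finite partition,
  and there the problem is finite dimensional: a supporting functional of the value function of the
  perturbed constraint \<open>H(u) \<le> y + w\<close> is an optimal \<open>\<eta>\<close>, and Jensen's inequality for the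
  conditional expectation shows that step functions suffice to compute the Orlicz norm of \<open>\<eta>\<close>.
  The same supporting functional argument gives a subgradient of \<open>T\<close> at \<open>E[X|\<pi>]\<close> among step
  functions; monotonicity and cash additivity make it minus a density, and since conditioning on
  \<open>\<pi>\<close> decreases \<open>T\<close>, it is a subgradient for all simple random variables.\<close>

section \<open>Convex analysis\<close>

text \<open>The infima behind the two value functions need not be attained, and the values might be
  infinite, so neither subdifferential calculus nor a minimax theorem is applied. Each value
  function is encoded as a convex relation \<open>E w r\<close>: under the perturbation
  \<open>w\<close>, some choice costs at most \<open>r\<close>. A supporting functional requires
  only convexity, \<open>0 \<le> r\<close> at \<open>w = 0\<close>, and a finite cost on both sides
  of 0 along every axis. For the constraint problem the last point comes from FGH1. For the
  subgradient problem it comes from finiteness of \<open>T\<close> on bounded variables, where FGH2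
  excludes the value -\<infinity>. The obstacle there is that FGH2 carries the factor
  \<open>inverse_at_one G\<close> outside \<open>F\<close>, whereas the constant \<open>H s\<close>
  has norm \<open>H s / inverse_at_one G\<close>, so the factor has to be moved inside. An infinite
  penalty leaves no perturbation problem to solve: weak duality makes every multiplier
  optimal.\<close>

lemma convex_relation_supported:
  fixes E :: "('i \<Rightarrow> real) \<Rightarrow> real \<Rightarrow> bool"
  assumes "finite I"
    and "\<And>w w' r r' t. E w r \<Longrightarrow> E w' r' \<Longrightarrow> 0 \<le> t \<Longrightarrow> t \<le> 1 \<Longrightarrow>
           E (\<lambda>i. (1 - t) * w i + t * w' i) ((1 - t) * r + t * r')"
    and "\<And>w r. E w r \<Longrightarrow> \<forall>i\<in>I. w i = 0 \<Longrightarrow> 0 \<le> r"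
    and "\<And>i. i \<in> I \<Longrightarrow> \<exists>w r. E w r \<and> 0 < w i \<and> (\<forall>j\<in>I - {i}. w j = 0)"
    and "\<And>i. i \<in> I \<Longrightarrow> \<exists>w r. E w r \<and> w i < 0 \<and> (\<forall>j\<in>I - {i}. w j = 0)"
  shows "\<exists>\<eta>. \<forall>w r. E w r \<longrightarrow> (\<Sum>i\<in>I. \<eta> i * w i) \<le> r"
  using assms
proof (induction I arbitrary: E rule: finite_induct)
  case empty
  then show ?case by simp
next
  case (insert k I)
  note convex = insert.prems(1) and zero = insert.prems(2)
  \<comment> \<open>\<open>P\<close> collects the slopes on the positive side of axis
    \<open>k\<close>. By \<open>opposite\<close> the slopes from the negative side lie below them,
    so a number in between, here the infimum, can serve as the coefficient of
    \<open>k\<close>.\<close>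
  define P where "P = {r / w k | w r. E w r \<and> 0 < w k \<and> (\<forall>j\<in>I. w j = 0)}"
  have opposite: "r' / w' k \<le> r / w k"
    if "E w r" "0 < w k" "\<forall>j\<in>I. w j = 0" and "E w' r'" "w' k < 0" "\<forall>j\<in>I. w' j = 0" for w r w' r'
  proof -
    \<comment> \<open>The weight at which the two points average to 0 in coordinate
      \<open>k\<close>, where values are nonnegative.\<close>
    define t where "t = w k / (w k - w' k)"
    have pos: "0 < w k - w' k" using that by simp
    have t: "0 \<le> t" "t \<le> 1" using that by (simp_all add: t_def field_simps)
    have t': "1 - t = - w' k / (w k - w' k)" using pos by (simp add: t_def field_simps)
    have "(1 - t) * w k + t * w' k = 0"
      unfolding t' by (simp add: t_def)
    then have "0 \<le> (1 - t) * r + t * r'"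
      using that by (intro zero[OF convex[OF that(1) that(4) t]]) auto
    also have "(1 - t) * r + t * r' = (w k * r' - w' k * r) / (w k - w' k)"
      unfolding t' by (simp add: t_def divide_simps)
    finally have "0 \<le> w k * r' - w' k * r" using pos by (simp add: zero_le_divide_iff)
    then show ?thesis using that by (simp add: field_simps)
  qed
  obtain w\<^sub>1 r\<^sub>1 where 1: "E w\<^sub>1 r\<^sub>1" "0 < w\<^sub>1 k" "\<forall>j\<in>I. w\<^sub>1 j = 0"
    using insert.prems(3)[of k] insert.hyps by auto
  obtain w\<^sub>2 r\<^sub>2 where 2: "E w\<^sub>2 r\<^sub>2" "w\<^sub>2 k < 0" "\<forall>j\<in>I. w\<^sub>2 j = 0"
    using insert.prems(4)[of k] insert.hyps by auto
  have P_ne: "P \<noteq> {}" using 1 by (auto simp: P_def)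
  have P_bdd: "bdd_below P"
    by (rule bdd_belowI[of _ "r\<^sub>2 / w\<^sub>2 k"]) (auto simp: P_def intro!: opposite 2)
  define c where "c = Inf P"
  have c: "c * w k \<le> r" if "E w r" "\<forall>j\<in>I. w j = 0" for w r
  proof -
    consider "0 < w k" | "w k < 0" | "w k = 0" by linarith
    then show ?thesis
    proof cases
      case 1
      then have "c \<le> r / w k" unfolding c_def
        using that by (intro cInf_lower P_bdd) (auto simp: P_def)
      then show ?thesis using 1 by (simp add: field_simps)
    next
      case 2
      then have "r / w k \<le> c" unfolding c_def
        using that by (intro cInf_greatest P_ne) (auto simp: P_def intro!: opposite)
      then show ?thesis using 2 by (simp add: field_simps)
    next
      case 3
      then show ?thesis using zero[OF that(1)] that(2) by simp
    qed
  qed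
  \<comment> \<open>After the linear term in \<open>k\<close> is subtracted, that coordinate is left
    free rather than set to 0, which amounts to a projection. Property \<open>c\<close> says
    precisely that values over 0 stay nonnegative under it, so the induction hypothesis applies to
    \<open>I\<close>.\<close>
  define E' where "E' w r \<longleftrightarrow> E w (r + c * w k)" for w r
  have "\<exists>\<eta>. \<forall>w r. E' w r \<longrightarrow> (\<Sum>i\<in>I. \<eta> i * w i) \<le> r"
  proof (rule insert.IH)
    fix w w' r r' t
    assume "E' w r" "E' w' r'" "0 \<le> t" "t \<le> (1::real)"
    then show "E' (\<lambda>i. (1 - t) * w i + t * w' i) ((1 - t) * r + t * r')"
      unfolding E'_def by (auto dest!: convex[of w _ w' _ t] simp: algebra_simps)
  next
    fix w r
    assume "E' w r" "\<forall>i\<in>I. w i = 0"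
    then show "0 \<le> r" using c[of w "r + c * w k"] by (simp add: E'_def)
  next
    fix i assume "i \<in> I"
    then obtain w r where "E w r" "0 < w i" "\<forall>j\<in>insert k I - {i}. w j = 0"
      using insert.prems(3)[of i] by auto
    then show "\<exists>w r. E' w r \<and> 0 < w i \<and> (\<forall>j\<in>I - {i}. w j = 0)"
      by (intro exI[of _ w] exI[of _ "r - c * w k"]) (auto simp: E'_def)
  next
    fix i assume "i \<in> I"
    then obtain w r where "E w r" "w i < 0" "\<forall>j\<in>insert k I - {i}. w j = 0"
      using insert.prems(4)[of i] by auto
    then show "\<exists>w r. E' w r \<and> w i < 0 \<and> (\<forall>j\<in>I - {i}. w j = 0)"
      by (intro exI[of _ w] exI[of _ "r - c * w k"]) (auto simp: E'_def)
  qed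
  then obtain \<eta> where \<eta>: "\<And>w r. E' w r \<Longrightarrow> (\<Sum>i\<in>I. \<eta> i * w i) \<le> r" by auto
  have "(\<Sum>i\<in>insert k I. (\<eta>(k := c)) i * w i) \<le> r" if "E w r" for w r
  proof -
    have "(\<Sum>i\<in>I. (\<eta>(k := c)) i * w i) = (\<Sum>i\<in>I. \<eta> i * w i)"
      using insert.hyps by (intro sum.cong) auto
    then show ?thesis using \<eta>[of w "r - c * w k"] that insert.hyps by (simp add: E'_def)
  qed
  then show ?case by blast
qed

text \<open>The point \<open>x\<^sub>1\<close> is a convex combination of 0 and \<open>x\<close>;
  solving the convexity inequality for \<open>f x\<close> puts the graph above the secant. Secant
  slopes from 0 take the place of one-sided derivatives below.\<close>

lemma convex_on_secant_minorant:
  fixes f :: "real \<Rightarrow> real"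
  assumes f: "convex_on {0..} f" and x\<^sub>1: "0 < x\<^sub>1" "x\<^sub>1 \<le> x"
  shows "f 0 + (f x\<^sub>1 - f 0) / x\<^sub>1 * x \<le> f x"
proof -
  define t where "t = x\<^sub>1 / x"
  have t: "0 < t" "t \<le> 1" using x\<^sub>1 by (auto simp: t_def field_simps)
  have "f ((1 - t) *\<^sub>R 0 + t *\<^sub>R x) \<le> (1 - t) * f 0 + t * f x"
    using x\<^sub>1 t by (intro convex_onD[OF f]) auto
  also have "(1 - t) *\<^sub>R 0 + t *\<^sub>R x = x\<^sub>1" using x\<^sub>1 by (simp add: t_def)
  finally have "f x\<^sub>1 - f 0 \<le> t * (f x - f 0)" by (simp add: algebra_simps)
  also have "t * (f x - f 0) = x\<^sub>1 * (f x - f 0) / x" by (simp add: t_def)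
  finally have "(f x\<^sub>1 - f 0) * x \<le> x\<^sub>1 * (f x - f 0)" using x\<^sub>1 by (simp add: pos_le_divide_eq)
  then show ?thesis using x\<^sub>1 by (simp add: field_simps)
qed

text \<open>For convex functions the divergence of \<open>f (h s) - c s\<close> is a statement about asymptotic
  slopes, which is insensitive to moving the factor \<open>c\<close> inside \<open>f\<close>.\<close>

lemma convex_composition_rescaled_bounded_below:
  fixes f h :: "real \<Rightarrow> real"
  assumes c: "0 < c"
    and f: "convex_on {0..} f" and f_mono: "\<And>x y. 0 \<le> x \<Longrightarrow> x \<le> y \<Longrightarrow> f x \<le> f y"
    and h: "convex_on {0..} h" and h_nonneg: "\<And>s. 0 \<le> h s"
    and h_lim: "filterlim h at_top at_top"
    and lim: "filterlim (\<lambda>s. f (h s) - c * s) at_top at_top"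
  shows "\<exists>K s\<^sub>1. \<forall>s\<ge>s\<^sub>1. K \<le> f (h s / c) - s"
proof -
  define a where "a x = (f x - f 0) / x" for x
  define b where "b s = (h s - h 0) / s" for s
  obtain s\<^sub>2 where s\<^sub>2: "0 < s\<^sub>2" "h 0 + 1 \<le> h s\<^sub>2"
    using eventually_happens[OF eventually_conj[OF filterlim_at_top[THEN iffD1, OF h_lim, rule_format, of "h 0 + 1"]
       eventually_gt_at_top[of 0]]] by auto
  then have b_pos: "0 < b s\<^sub>2" by (simp add: b_def)
  have h_pos: "0 < h s" if "s\<^sub>2 \<le> s" for s
  proof -
    have "0 \<le> b s\<^sub>2 * s" using b_pos s\<^sub>2 that by auto
    moreover have "1 \<le> b s\<^sub>2 * s\<^sub>2" using s\<^sub>2 by (simp add: b_def)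
    moreover have "b s\<^sub>2 * s\<^sub>2 \<le> b s\<^sub>2 * s" using b_pos that by simp
    ultimately show ?thesis
      using convex_on_secant_minorant[OF h, of s\<^sub>2 s] s\<^sub>2 that h_nonneg[of 0] by (simp add: b_def)
  qed
  \<comment> \<open>If all products of secant slopes were at most \<open>c\<close>, then
    \<open>f (h s)\<close> would exceed \<open>c * s\<close> by at most the constant
    \<open>C\<close>, against the assumed divergence.\<close>
  have "\<exists>x>0. \<exists>s>0. c < a x * b s"
  proof (rule ccontr)
    assume "\<not> ?thesis"
    then have ab: "a x * b s \<le> c" if "0 < x" "0 < s" for x s using that by force
    define C where "C = f 0 + c / b s\<^sub>2 * h 0"
    have bound: "f (h s) - c * s \<le> C" if "s\<^sub>2 \<le> s" for s
    proof -
      have pos: "0 < s" "0 < h s" using that s\<^sub>2 h_pos[OF that] by auto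
      have "a (h s) \<le> c / b s\<^sub>2"
        using ab[of "h s" s\<^sub>2] pos s\<^sub>2 b_pos by (simp add: field_simps)
      then have "a (h s) * h 0 \<le> c / b s\<^sub>2 * h 0" by (intro mult_right_mono h_nonneg)
      moreover have "a (h s) * b s * s \<le> c * s" using ab[of "h s" s] pos by (intro mult_right_mono) auto
      moreover have "f (h s) = f 0 + a (h s) * h s" using pos by (simp add: a_def)
      moreover have "h s = h 0 + b s * s" using pos by (simp add: b_def)
      then have "a (h s) * h s = a (h s) * h 0 + a (h s) * b s * s"
        by (metis distrib_left mult.assoc)
      ultimately show ?thesis by (simp add: C_def)
    qed
    have "eventually (\<lambda>s. C + 1 \<le> f (h s) - c * s) at_top"
      using lim by (simp add: filterlim_at_top)
    from eventually_happens[OF eventually_conj[OF this eventually_ge_at_top[of s\<^sub>2]]]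
    show False using bound by force
  qed
  then obtain x\<^sub>1 s\<^sub>1 where 1: "0 < x\<^sub>1" "0 < s\<^sub>1" "c < a x\<^sub>1 * b s\<^sub>1" by auto
  have a_nonneg: "0 \<le> a x\<^sub>1" using f_mono[of 0 x\<^sub>1] 1 by (simp add: a_def)
  \<comment> \<open>Giving up \<open>a x\<^sub>1 * x\<^sub>1\<close> makes one line a minorant of
    \<open>f\<close> on the whole half line: beyond \<open>x\<^sub>1\<close> it lies below the
    secant, before \<open>x\<^sub>1\<close> it lies below \<open>f 0\<close>.\<close>
  define K where "K = f 0 - a x\<^sub>1 * x\<^sub>1"
  have "K \<le> f (h s / c) - s" if s: "s\<^sub>1 \<le> s" for s
  proof -
    let ?x = "h s / c"
    have x: "0 \<le> ?x" using c h_nonneg[of s] by simp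
    have f_ge: "f 0 + a x\<^sub>1 * (?x - x\<^sub>1) \<le> f ?x"
    proof (cases "x\<^sub>1 \<le> ?x")
      case True
      then show ?thesis using convex_on_secant_minorant[OF f 1(1) True] a_nonneg 1
        by (simp add: a_def[symmetric] right_diff_distrib) (smt (verit) mult_nonneg_nonneg)
    next
      case False
      then have "a x\<^sub>1 * (?x - x\<^sub>1) \<le> 0" using a_nonneg by (intro mult_nonneg_nonpos) auto
      then show ?thesis using f_mono[of 0 ?x] x by simp
    qed
    have "b s\<^sub>1 * s \<le> h s"
      using convex_on_secant_minorant[OF h 1(2) s] h_nonneg[of 0] by (simp add: b_def)
    then have "a x\<^sub>1 * (b s\<^sub>1 * s) \<le> a x\<^sub>1 * h s" using a_nonneg by (intro mult_left_mono)
    moreover have "c * s \<le> a x\<^sub>1 * b s\<^sub>1 * s" using 1 s by (intro mult_right_mono) auto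
    ultimately have "c * s \<le> a x\<^sub>1 * h s" by (simp add: mult.assoc)
    then have "s \<le> a x\<^sub>1 * ?x" using c by (simp add: field_simps)
    then show ?thesis using f_ge by (simp add: K_def algebra_simps)
  qed
  then show ?thesis by blast
qed

section \<open>Expectations\<close>

lemma ereal_expectation_real:
  assumes "integrable M f" and "AE \<omega> in M. h \<omega> = ereal (f \<omega>)"
  shows "ereal_expectation M h = ereal (\<integral>\<omega>. f \<omega> \<partial>M)"
proof -
  have fin: "(\<integral>\<^sup>+ \<omega>. ennreal (f \<omega>) \<partial>M) \<noteq> \<infinity>" "(\<integral>\<^sup>+ \<omega>. ennreal (- f \<omega>) \<partial>M) \<noteq> \<infinity>"
    using assms(1) by (auto simp: real_integrable_def)
  have "(\<integral>\<^sup>+ \<omega>. e2ennreal (h \<omega>) \<partial>M) = (\<integral>\<^sup>+ \<omega>. ennreal (f \<omega>) \<partial>M)"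
    using assms(2) by (intro nn_integral_cong_AE) (auto simp: e2ennreal_ereal)
  moreover have "(\<integral>\<^sup>+ \<omega>. e2ennreal (- h \<omega>) \<partial>M) = (\<integral>\<^sup>+ \<omega>. ennreal (- f \<omega>) \<partial>M)"
    using assms(2) by (intro nn_integral_cong_AE) (auto simp: e2ennreal_ereal)
  ultimately show ?thesis
    using fin unfolding ereal_expectation_def real_lebesgue_integral_def[OF assms(1)]
    by (cases "\<integral>\<^sup>+ \<omega>. ennreal (f \<omega>) \<partial>M"; cases "\<integral>\<^sup>+ \<omega>. ennreal (- f \<omega>) \<partial>M")
       (auto simp: enn2real_def)
qed

lemma ereal_expectation_le_nn_integral:
  "ereal_expectation M h \<le> enn2ereal (\<integral>\<^sup>+ \<omega>. e2ennreal (h \<omega>) \<partial>M)"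
  unfolding ereal_expectation_def by (intro ereal_diff_le_self) simp

lemma ereal_expectation_mono:
  assumes "AE \<omega> in M. f \<omega> \<le> h \<omega>"
  shows "ereal_expectation M f \<le> ereal_expectation M h"
  unfolding ereal_expectation_def
proof (rule ereal_minus_mono)
  show "enn2ereal (\<integral>\<^sup>+ \<omega>. e2ennreal (f \<omega>) \<partial>M) \<le> enn2ereal (\<integral>\<^sup>+ \<omega>. e2ennreal (h \<omega>) \<partial>M)"
    unfolding less_eq_ennreal.rep_eq[symmetric]
    using assms by (intro nn_integral_mono_AE) (auto intro!: e2ennreal_mono)
  show "enn2ereal (\<integral>\<^sup>+ \<omega>. e2ennreal (- h \<omega>) \<partial>M) \<le> enn2ereal (\<integral>\<^sup>+ \<omega>. e2ennreal (- f \<omega>) \<partial>M)"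
    unfolding less_eq_ennreal.rep_eq[symmetric]
    using assms by (intro nn_integral_mono_AE) (auto intro!: e2ennreal_mono)
qed

section \<open>Orlicz norms\<close>

text \<open>The essentially bounded variables, a larger class than the simple ones: closure under
  sums, products and monotone maps needs only a bound and no common partition, and Luxemburg norms
  on it are finite.\<close>

definition bounded_rvs :: "'a measure \<Rightarrow> ('a \<Rightarrow> real) set" where
  "bounded_rvs M = {X \<in> borel_measurable M. \<exists>B. AE \<omega> in M. \<bar>X \<omega>\<bar> \<le> B}"

lemma bounded_rvs_measurable: "X \<in> bounded_rvs M \<Longrightarrow> X \<in> borel_measurable M"
  by (simp add: bounded_rvs_def)

lemma bounded_rvs_boundE:
  assumes "X \<in> bounded_rvs M"
  obtains B where "0 < B" "AE \<omega> in M. \<bar>X \<omega>\<bar> \<le> B"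
proof -
  obtain B where "AE \<omega> in M. \<bar>X \<omega>\<bar> \<le> B" using assms by (auto simp: bounded_rvs_def)
  then have "AE \<omega> in M. \<bar>X \<omega>\<bar> \<le> max 1 B" by eventually_elim auto
  then show thesis by (intro that[of "max 1 B"]) auto
qed

lemma simple_rvs_subset_bounded_rvs: "simple_rvs M \<subseteq> bounded_rvs M"
proof
  fix X assume "X \<in> simple_rvs M"
  then obtain Z where X: "X \<in> borel_measurable M" "AE \<omega> in M. X \<omega> = Z \<omega>" and Z: "simple_function M Z"
    by (auto simp: simple_rvs_def)
  have fin: "finite ((\<lambda>z. \<bar>z\<bar>) ` Z ` space M)" using Z by (simp add: simple_functionD)
  have "AE \<omega> in M. \<bar>X \<omega>\<bar> \<le> Max ((\<lambda>z. \<bar>z\<bar>) ` Z ` space M)"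
    using X(2) AE_space
  proof eventually_elim
    case (elim \<omega>)
    then show ?case by (intro Max_ge[OF fin]) auto
  qed
  then show "X \<in> bounded_rvs M" using X by (auto simp: bounded_rvs_def)
qed

lemma (in finite_measure) bounded_rvs_integrable: "X \<in> bounded_rvs M \<Longrightarrow> integrable M X"
  by (rule bounded_rvs_boundE, assumption, rule integrable_const_bound)
     (simp_all add: bounded_rvs_measurable)

lemma bounded_rvs_mono_compose:
  fixes f :: "real \<Rightarrow> real"
  assumes "mono f" and X: "X \<in> bounded_rvs M"
  shows "(\<lambda>\<omega>. f (X \<omega>)) \<in> bounded_rvs M"
proof -
  have [measurable]: "f \<in> borel_measurable borel" using \<open>mono f\<close> by (rule borel_measurable_mono)
  have [measurable]: "X \<in> borel_measurable M" using X by (rule bounded_rvs_measurable)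
  obtain B where "AE \<omega> in M. \<bar>X \<omega>\<bar> \<le> B" using X by (rule bounded_rvs_boundE)
  then have "AE \<omega> in M. \<bar>f (X \<omega>)\<bar> \<le> max \<bar>f (- B)\<bar> \<bar>f B\<bar>"
  proof eventually_elim
    case (elim \<omega>)
    then have "f (- B) \<le> f (X \<omega>)" "f (X \<omega>) \<le> f B" by (auto intro!: monoD[OF \<open>mono f\<close>])
    then show ?case by auto
  qed
  then show ?thesis by (auto simp: bounded_rvs_def)
qed

lemma bounded_rvs_mult:
  assumes "X \<in> bounded_rvs M" "Y \<in> bounded_rvs M"
  shows "(\<lambda>\<omega>. X \<omega> * Y \<omega>) \<in> bounded_rvs M"
proof -
  obtain A where A: "0 < A" "AE \<omega> in M. \<bar>X \<omega>\<bar> \<le> A" using assms(1) by (rule bounded_rvs_boundE)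
  obtain B where B: "0 < B" "AE \<omega> in M. \<bar>Y \<omega>\<bar> \<le> B" using assms(2) by (rule bounded_rvs_boundE)
  have "AE \<omega> in M. \<bar>X \<omega> * Y \<omega>\<bar> \<le> A * B"
    using A(2) B(2) by eventually_elim (auto simp: abs_mult intro!: mult_mono)
  then show ?thesis using assms by (auto simp: bounded_rvs_def)
qed

lemma bounded_rvs_add:
  assumes "X \<in> bounded_rvs M" "Y \<in> bounded_rvs M"
  shows "(\<lambda>\<omega>. X \<omega> + Y \<omega>) \<in> bounded_rvs M"
proof -
  obtain A where A: "AE \<omega> in M. \<bar>X \<omega>\<bar> \<le> A" using assms(1) by (rule bounded_rvs_boundE)
  obtain B where B: "AE \<omega> in M. \<bar>Y \<omega>\<bar> \<le> B" using assms(2) by (rule bounded_rvs_boundE)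
  have "AE \<omega> in M. \<bar>X \<omega> + Y \<omega>\<bar> \<le> A + B"
    using A B by eventually_elim auto
  then show ?thesis using assms by (auto simp: bounded_rvs_def)
qed

lemma bounded_rvs_const: "(\<lambda>_. c) \<in> bounded_rvs M"
  by (auto simp: bounded_rvs_def)

lemma bounded_rvs_cmult: "X \<in> bounded_rvs M \<Longrightarrow> (\<lambda>\<omega>. c * X \<omega>) \<in> bounded_rvs M"
  using bounded_rvs_mult[OF bounded_rvs_const] by blast

lemma bounded_rvs_const_minus: "X \<in> bounded_rvs M \<Longrightarrow> (\<lambda>\<omega>. c - X \<omega>) \<in> bounded_rvs M"
  using bounded_rvs_add[OF bounded_rvs_const[of c] bounded_rvs_cmult[of X M "-1"]] by simp

lemma orlicz_spaceD_integrable: "X \<in> orlicz_space M G \<Longrightarrow> integrable M X"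
  by (simp add: orlicz_space_def)

section \<open>Convex conjugates and Young's inequality\<close>

lemma convex_conjugate_on_mono:
  assumes "D \<subseteq> {0..}" "y \<le> y'"
  shows "convex_conjugate_on D f y \<le> convex_conjugate_on D f y'"
  unfolding convex_conjugate_on_def
proof (intro SUP_subset_mono[OF order_refl] ereal_minus_mono order_refl)
  fix x assume "x \<in> D"
  then have "0 \<le> x" using assms by auto
  then show "ereal (x * y) \<le> ereal (x * y')" using assms by (simp add: mult_left_mono)
qed

text \<open>Superlevel sets of a monotone function are intervals. This serves the conjugate of
  \<open>G\<close>, which may take the value \<infinity>.\<close>

lemma borel_measurable_mono_ereal:
  fixes f :: "real \<Rightarrow> ereal"
  assumes "mono f"
  shows "f \<in> borel_measurable borel"
proof (rule borel_measurableI_greater)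
  fix y
  have "is_interval {x. y < f x}"
    unfolding is_interval_1 using monoD[OF \<open>mono f\<close>] by (auto intro: less_le_trans)
  then show "{x \<in> space borel. y < f x} \<in> sets borel"
    using real_interval_borel_measurable by simp
qed

lemma e2ennreal_add_ereal: "0 \<le> x \<Longrightarrow> 0 \<le> y \<Longrightarrow> e2ennreal (x + ereal y) = e2ennreal x + ennreal y"
  by (cases x) simp_all

lemma young_inequality:
  assumes "x \<in> D" "\<bar>f x\<bar> \<noteq> \<infinity>"
  shows "ereal (x * y) \<le> convex_conjugate_on D f y + f x"
proof -
  have "ereal (x * y) - f x \<le> convex_conjugate_on D f y"
    unfolding convex_conjugate_on_def using assms(1) by (rule SUP_upper)
  then show ?thesis using assms(2) by (cases "f x"; cases "convex_conjugate_on D f y") auto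
qed

section \<open>Real-valued Orlicz functions\<close>

locale real_orlicz = prob_space M for M :: "'a measure" +
  fixes G :: "real \<Rightarrow> ereal"
  assumes G_orlicz: "orlicz_function G"
    and G_real: "\<forall>x\<ge>0. G x < \<infinity>"
begin

text \<open>The even extension of \<open>G\<close> to the real line, real-valued because
  \<open>G\<close> is finite on the half line. It is convex everywhere, hence continuous, and
  Jensen's inequality applies to it for signed variables.\<close>

definition g :: "real \<Rightarrow> real" where "g x = real_of_ereal (G \<bar>x\<bar>)"

abbreviation lux :: "('a \<Rightarrow> real) \<Rightarrow> ereal" where "lux X \<equiv> luxemburg_norm M G X"

text \<open>The expression that \<open>tnrm\<close> feeds to \<open>F\<close>. On bounded variables
  it is the norm itself (\<open>lux_nrm\<close>); an infinite norm would be read as 0.\<close>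

definition nrm :: "('a \<Rightarrow> real) \<Rightarrow> real" where "nrm X = real_of_ereal (lux X)"

abbreviation c\<^sub>0 :: real where "c\<^sub>0 \<equiv> inverse_at_one G"

lemma G_nonneg: "0 \<le> x \<Longrightarrow> 0 \<le> G x"
  using G_orlicz by (auto simp: orlicz_function_def)

lemma G_abs: "G \<bar>x\<bar> = ereal (g x)"
proof -
  have "0 \<le> G \<bar>x\<bar>" "G \<bar>x\<bar> < \<infinity>" using G_nonneg G_real by auto
  then show ?thesis unfolding g_def by (cases "G \<bar>x\<bar>") auto
qed

lemma G_nonneg_arg: "0 \<le> x \<Longrightarrow> G x = ereal (g x)"
  using G_abs[of x] by simp

lemma g_abs: "g \<bar>x\<bar> = g x" by (simp add: g_def)

lemma g_nonneg: "0 \<le> g x"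
  using G_nonneg[of "\<bar>x\<bar>"] by (simp add: G_abs)

lemma g_zero: "g 0 = 0"
  using G_orlicz by (simp add: g_def orlicz_function_def)

lemma g_convex_nonneg: "convex_on {0..} g"
proof (rule convex_onI)
  fix t x y :: real
  assume t: "0 < t" "t < 1" and xy: "x \<in> {0..}" "y \<in> {0..}"
  have "G ((1 - t) * x + t * y) \<le> ereal (1 - t) * G x + ereal t * G y"
    using G_orlicz t xy unfolding orlicz_function_def ereal_convex_on_def by auto
  then show "g ((1 - t) *\<^sub>R x + t *\<^sub>R y) \<le> (1 - t) * g x + t * g y"
    using t xy by (simp add: G_nonneg_arg)
qed simp

text \<open>A nonnegative convex function that vanishes at 0 has nonnegative secant slopes from 0,
  so it increases on the half line.\<close>

lemma g_mono: assumes "\<bar>x\<bar> \<le> \<bar>y\<bar>" shows "g x \<le> g y"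
proof -
  have "g \<bar>x\<bar> \<le> g \<bar>y\<bar>"
  proof (cases "x = 0")
    case True
    then show ?thesis using g_zero g_nonneg by simp
  next
    case False
    then have "(g \<bar>x\<bar> / \<bar>x\<bar>) * \<bar>y\<bar> \<le> g \<bar>y\<bar>"
      using convex_on_secant_minorant[OF g_convex_nonneg, of "\<bar>x\<bar>" "\<bar>y\<bar>"] assms g_zero by simp
    moreover have "g \<bar>x\<bar> / \<bar>x\<bar> * \<bar>x\<bar> \<le> (g \<bar>x\<bar> / \<bar>x\<bar>) * \<bar>y\<bar>"
      using assms g_nonneg by (intro mult_left_mono) auto
    ultimately show ?thesis using False by simp
  qed
  then show ?thesis by (simp add: g_abs)
qed

text \<open>The triangle inequality and monotonicity in the modulus reduce the claim to convexity on
  the half line.\<close>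

lemma g_convex: "convex_on UNIV g"
proof (rule convex_onI)
  fix t x y :: real
  assume t: "0 < t" "t < 1"
  have "g ((1 - t) * x + t * y) \<le> g ((1 - t) * \<bar>x\<bar> + t * \<bar>y\<bar>)"
  proof (rule g_mono)
    have "\<bar>(1 - t) * x + t * y\<bar> \<le> \<bar>(1 - t) * x\<bar> + \<bar>t * y\<bar>" by (rule abs_triangle_ineq)
    also have "\<dots> = \<bar>(1 - t) * \<bar>x\<bar> + t * \<bar>y\<bar>\<bar>" using t by (simp add: abs_mult)
    finally show "\<bar>(1 - t) * x + t * y\<bar> \<le> \<bar>(1 - t) * \<bar>x\<bar> + t * \<bar>y\<bar>\<bar>" .
  qed
  also have "\<dots> \<le> (1 - t) * g \<bar>x\<bar> + t * g \<bar>y\<bar>"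
    using convex_onD[OF g_convex_nonneg, of t "\<bar>x\<bar>" "\<bar>y\<bar>"] t by simp
  finally show "g ((1 - t) *\<^sub>R x + t *\<^sub>R y) \<le> (1 - t) * g x + t * g y" by (simp add: g_abs)
qed simp

lemma g_continuous: "continuous_on UNIV g"
  using g_convex by (intro convex_on_continuous) auto

lemma g_measurable[measurable]: "g \<in> borel_measurable borel"
  using g_continuous by (rule borel_measurable_continuous_onI)

lemma g_unbounded: obtains x where "0 < x" "K < g x"
proof -
  have "(G \<longlongrightarrow> \<infinity>) at_top" using G_orlicz by (simp add: orlicz_function_def)
  then have "eventually (\<lambda>x. ereal K < G x) at_top" by (simp add: tendsto_PInfty)
  from eventually_happens[OF eventually_conj[OF this eventually_gt_at_top[of 0]]]
  obtain x where "ereal K < G x" "0 < x" by auto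
  then show thesis by (intro that[of x]) (auto simp: G_nonneg_arg)
qed

lemma sublevel_one: "{t. 0 < t \<and> G t \<le> 1} = {t. 0 < t \<and> g t \<le> 1}"
  by (auto simp: G_nonneg_arg)

lemma sublevel_one_bdd: "bdd_above {t. 0 < t \<and> g t \<le> 1}"
proof -
  obtain x where x: "0 < x" "1 < g x" by (rule g_unbounded)
  have "t \<le> x" if "0 < t" "g t \<le> 1" for t
    using g_mono[of x t] that x by (cases "t \<le> x") auto
  then show ?thesis by (intro bdd_aboveI[of _ x]) auto
qed

lemma sublevel_one_nonempty: "{t. 0 < t \<and> g t \<le> 1} \<noteq> {}"
proof -
  have "isCont g 0" using g_continuous by (simp add: continuous_on_eq_continuous_at)
  then have "(g \<longlongrightarrow> 0) (at_right 0)"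
    using g_zero by (metis isCont_def at_within_le_at filterlim_mono order_refl)
  then have "eventually (\<lambda>x. g x < 1) (at_right 0)" by (rule order_tendstoD) simp
  from eventually_happens[OF eventually_conj[OF this eventually_at_right_less]]
  obtain t where "g t < 1" "0 < t" by auto
  then show ?thesis by force
qed

lemma le_inverse_at_one: "g t \<le> 1 \<Longrightarrow> 0 < t \<Longrightarrow> t \<le> c\<^sub>0"
  unfolding inverse_at_one_def sublevel_one by (intro cSup_upper sublevel_one_bdd) auto

lemma inverse_at_one_pos: "0 < c\<^sub>0"
  using sublevel_one_nonempty le_inverse_at_one by force

text \<open>Sublevel sets of the continuous \<open>g\<close> are closed, so the supremum that
  defines \<open>c\<^sub>0\<close> is attained.\<close>

lemma g_inverse_at_one: "g c\<^sub>0 \<le> 1"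
proof -
  have "c\<^sub>0 \<in> closure {t. 0 < t \<and> g t \<le> 1}"
    unfolding inverse_at_one_def sublevel_one
    by (intro closure_contains_Sup sublevel_one_nonempty sublevel_one_bdd)
  moreover have "closed {t. g t \<le> 1}"
    using g_continuous by (intro closed_Collect_le) auto
  then have "closure {t. 0 < t \<and> g t \<le> 1} \<subseteq> {t. g t \<le> 1}" by (intro closure_minimal) auto
  ultimately show ?thesis by auto
qed

section \<open>The Luxemburg norm\<close>

lemma luxemburg_norm_eq: "lux X = Inf {ereal c | c. 0 < c \<and> (\<integral>\<^sup>+ \<omega>. ennreal (g (X \<omega> / c)) \<partial>M) \<le> 1}"
proof -
  have "G (\<bar>X \<omega>\<bar> / c) = ereal (g (X \<omega> / c))" if "0 < c" for c \<omega>
    using that G_abs[of "X \<omega> / c"] by simp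
  then have "(0 < c \<and> (\<integral>\<^sup>+ \<omega>. e2ennreal (G (\<bar>X \<omega>\<bar> / c)) \<partial>M) \<le> 1) \<longleftrightarrow>
      (0 < c \<and> (\<integral>\<^sup>+ \<omega>. ennreal (g (X \<omega> / c)) \<partial>M) \<le> 1)" for c
    by auto
  then show ?thesis unfolding luxemburg_norm_def by simp
qed

lemma lux_leI: "0 < c \<Longrightarrow> (\<integral>\<^sup>+ \<omega>. ennreal (g (X \<omega> / c)) \<partial>M) \<le> 1 \<Longrightarrow> lux X \<le> ereal c"
  unfolding luxemburg_norm_eq by (rule Inf_lower) auto

lemma lux_nonneg: "0 \<le> lux X"
  unfolding luxemburg_norm_eq by (rule Inf_greatest) auto

text \<open>Enlarging the denominator decreases \<open>g\<close>, so every real strictly above the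
  infimum is admissible. Attainment of the infimum is thereby avoided: later proofs use strict upper
  bounds, typically the norm plus some \<open>e\<close>.\<close>

lemma lux_lessD:
  assumes "lux X < ereal c"
  shows "0 < c" and "(\<integral>\<^sup>+ \<omega>. ennreal (g (X \<omega> / c)) \<partial>M) \<le> 1"
proof -
  obtain d where d: "0 < d" "(\<integral>\<^sup>+ \<omega>. ennreal (g (X \<omega> / d)) \<partial>M) \<le> 1" "d < c"
    using assms unfolding luxemburg_norm_eq Inf_less_iff by auto
  then show "0 < c" by simp
  have "g (X \<omega> / c) \<le> g (X \<omega> / d)" for \<omega>
    using d by (intro g_mono) (auto simp: abs_divide intro!: divide_left_mono)
  then have "(\<integral>\<^sup>+ \<omega>. ennreal (g (X \<omega> / c)) \<partial>M) \<le> (\<integral>\<^sup>+ \<omega>. ennreal (g (X \<omega> / d)) \<partial>M)"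
    by (intro nn_integral_mono ennreal_leI)
  then show "(\<integral>\<^sup>+ \<omega>. ennreal (g (X \<omega> / c)) \<partial>M) \<le> 1" using d by simp
qed

lemma lux_le_luxI:
  assumes "\<And>c. lux X < ereal c \<Longrightarrow> lux Y \<le> ereal c"
  shows "lux Y \<le> lux X"
proof (rule dense_ge)
  fix c assume "lux X < c"
  then show "lux Y \<le> c" using assms lux_nonneg[of X] by (cases c) auto
qed

lemma lux_mono: assumes "AE \<omega> in M. \<bar>X \<omega>\<bar> \<le> \<bar>Y \<omega>\<bar>" shows "lux X \<le> lux Y"
proof (rule lux_le_luxI)
  fix c assume c: "lux Y < ereal c"
  have "AE \<omega> in M. g (X \<omega> / c) \<le> g (Y \<omega> / c)"
    using assms by eventually_elim (use lux_lessD(1)[OF c] in \<open>auto intro!: g_mono divide_right_mono simp: abs_divide\<close>)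
  then have "(\<integral>\<^sup>+ \<omega>. ennreal (g (X \<omega> / c)) \<partial>M) \<le> (\<integral>\<^sup>+ \<omega>. ennreal (g (Y \<omega> / c)) \<partial>M)"
    by (intro nn_integral_mono_AE) (auto intro: ennreal_leI)
  also have "\<dots> \<le> 1" using lux_lessD[OF c] by simp
  finally show "lux X \<le> ereal c" using lux_lessD(1)[OF c] by (intro lux_leI)
qed

text \<open>The scale \<open>k / c\<^sub>0\<close> turns the bound \<open>k\<close> into
  \<open>c\<^sub>0\<close>, where \<open>g\<close> is at most 1. With \<open>const_le_nrm\<close> it
  follows that a positive constant \<open>k\<close> has norm exactly
  \<open>k / c\<^sub>0\<close>.\<close>

lemma lux_bound: assumes "0 < k" "AE \<omega> in M. \<bar>X \<omega>\<bar> \<le> k" shows "lux X \<le> ereal (k / c\<^sub>0)"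
proof (rule lux_leI)
  show "0 < k / c\<^sub>0" using assms(1) inverse_at_one_pos by simp
  have "AE \<omega> in M. g (X \<omega> / (k / c\<^sub>0)) \<le> 1"
    using assms(2)
  proof eventually_elim
    case (elim \<omega>)
    then have "g (X \<omega> / (k / c\<^sub>0)) \<le> g c\<^sub>0"
      using assms(1) inverse_at_one_pos by (intro g_mono) (auto simp: abs_mult abs_divide field_simps)
    then show ?case using g_inverse_at_one by simp
  qed
  then have "(\<integral>\<^sup>+ \<omega>. ennreal (g (X \<omega> / (k / c\<^sub>0))) \<partial>M) \<le> (\<integral>\<^sup>+ \<omega>. 1 \<partial>M)"
    by (intro nn_integral_mono_AE) (auto simp: ennreal_le_1)
  then show "(\<integral>\<^sup>+ \<omega>. ennreal (g (X \<omega> / (k / c\<^sub>0))) \<partial>M) \<le> 1" by (simp add: emeasure_space_1)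
qed

lemma lux_nrm: assumes "X \<in> bounded_rvs M" shows "lux X = ereal (nrm X)"
proof -
  obtain B where "0 < B" "AE \<omega> in M. \<bar>X \<omega>\<bar> \<le> B" using assms by (rule bounded_rvs_boundE)
  then have "lux X \<le> ereal (B / c\<^sub>0)" by (rule lux_bound)
  then show ?thesis using lux_nonneg[of X] unfolding nrm_def by (cases "lux X") auto
qed

lemma nrm_nonneg: "0 \<le> nrm X"
  unfolding nrm_def using lux_nonneg by (simp add: real_of_ereal_pos)

lemma nrm_mono:
  assumes "X \<in> bounded_rvs M" "Y \<in> bounded_rvs M" "AE \<omega> in M. \<bar>X \<omega>\<bar> \<le> \<bar>Y \<omega>\<bar>"
  shows "nrm X \<le> nrm Y"
  using lux_mono[OF assms(3)] lux_nrm assms(1,2) by simp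

lemma nrm_bound:
  assumes "0 < k" "AE \<omega> in M. \<bar>X \<omega>\<bar> \<le> k"
  shows "nrm X \<le> k / c\<^sub>0"
  using lux_bound[OF assms] lux_nonneg[of X] unfolding nrm_def by (cases "lux X") auto

lemma lux_scale_le: assumes "lux Y \<le> 1" "0 < x" shows "lux (\<lambda>\<omega>. x * Y \<omega>) \<le> ereal x"
proof (rule dense_ge)
  fix c assume c: "ereal x < c"
  show "lux (\<lambda>\<omega>. x * Y \<omega>) \<le> c"
  proof (cases c)
    case (real r)
    then have r: "x < r" using c by simp
    have "lux Y < ereal (r / x)"
      using assms r by (intro le_less_trans[OF assms(1)]) (simp add: one_ereal_def field_simps)
    from lux_lessD[OF this] show ?thesis
      using r assms unfolding real by (intro lux_leI) (simp_all add: field_simps)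
  qed (use c in auto)
qed

lemma nrm_convex:
  assumes X: "X \<in> bounded_rvs M" and Y: "Y \<in> bounded_rvs M" and t: "0 \<le> t" "t \<le> 1"
  shows "nrm (\<lambda>\<omega>. (1 - t) * X \<omega> + t * Y \<omega>) \<le> (1 - t) * nrm X + t * nrm Y"
proof (rule field_le_epsilon)
  fix e :: real assume e: "0 < e"
  have [measurable]: "X \<in> borel_measurable M" "Y \<in> borel_measurable M"
    using X Y by (auto intro: bounded_rvs_measurable)
  define a where "a = nrm X + e"
  define b where "b = nrm Y + e"
  have ab: "0 < a" "0 < b" using e nrm_nonneg[of X] nrm_nonneg[of Y] by (auto simp: a_def b_def)
  have a: "(\<integral>\<^sup>+ \<omega>. ennreal (g (X \<omega> / a)) \<partial>M) \<le> 1"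
    by (rule lux_lessD) (use e in \<open>simp add: lux_nrm[OF X] a_def\<close>)
  have b: "(\<integral>\<^sup>+ \<omega>. ennreal (g (Y \<omega> / b)) \<partial>M) \<le> 1"
    by (rule lux_lessD) (use e in \<open>simp add: lux_nrm[OF Y] b_def\<close>)
  define c where "c = (1 - t) * a + t * b"
  have c: "0 < c"
  proof (cases "t = 0")
    case False
    then show ?thesis unfolding c_def using t ab by (intro add_nonneg_pos) auto
  qed (use ab in \<open>simp add: c_def\<close>)
  \<comment> \<open>The weight that makes the combination divided by \<open>c\<close> a convex
    combination of \<open>X \<omega> / a\<close> and \<open>Y \<omega> / b\<close>, for both of
    which the expectation of \<open>g\<close> is at most 1.\<close>
  define \<theta> where "\<theta> = t * b / c"
  have \<theta>: "0 \<le> \<theta>" "\<theta> \<le> 1" using t ab c by (auto simp: \<theta>_def c_def field_simps)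
  have \<theta>': "1 - \<theta> = (1 - t) * a / c" using c by (simp add: \<theta>_def field_simps) (simp add: c_def algebra_simps)
  have "g (((1 - t) * X \<omega> + t * Y \<omega>) / c) \<le> (1 - \<theta>) * g (X \<omega> / a) + \<theta> * g (Y \<omega> / b)" for \<omega>
  proof -
    have "((1 - t) * X \<omega> + t * Y \<omega>) / c = (1 - \<theta>) *\<^sub>R (X \<omega> / a) + \<theta> *\<^sub>R (Y \<omega> / b)"
      unfolding \<theta>' using ab c by (simp add: \<theta>_def add_divide_distrib)
    then show ?thesis using convex_onD[OF g_convex \<theta>, of "X \<omega> / a" "Y \<omega> / b"] by simp
  qed
  then have "(\<integral>\<^sup>+ \<omega>. ennreal (g (((1 - t) * X \<omega> + t * Y \<omega>) / c)) \<partial>M)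
      \<le> (\<integral>\<^sup>+ \<omega>. ennreal (1 - \<theta>) * ennreal (g (X \<omega> / a)) + ennreal \<theta> * ennreal (g (Y \<omega> / b)) \<partial>M)"
    using \<theta> g_nonneg by (intro nn_integral_mono) (simp flip: ennreal_mult ennreal_plus add: ennreal_leI)
  also have "\<dots> = ennreal (1 - \<theta>) * (\<integral>\<^sup>+ \<omega>. ennreal (g (X \<omega> / a)) \<partial>M)
      + ennreal \<theta> * (\<integral>\<^sup>+ \<omega>. ennreal (g (Y \<omega> / b)) \<partial>M)"
    by (simp add: nn_integral_add nn_integral_cmult)
  also have "\<dots> \<le> ennreal (1 - \<theta>) * 1 + ennreal \<theta> * 1"
    by (intro add_mono mult_left_mono a b) auto
  also have "\<dots> = 1" using \<theta> by (simp flip: ennreal_plus)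
  finally have "lux (\<lambda>\<omega>. (1 - t) * X \<omega> + t * Y \<omega>) \<le> ereal c" by (intro lux_leI c)
  then have "nrm (\<lambda>\<omega>. (1 - t) * X \<omega> + t * Y \<omega>) \<le> c"
    using lux_nrm[OF bounded_rvs_add[OF bounded_rvs_cmult[OF X] bounded_rvs_cmult[OF Y]]] by simp
  also have "c = (1 - t) * nrm X + t * nrm Y + e" by (simp add: c_def a_def b_def algebra_simps)
  finally show "nrm (\<lambda>\<omega>. (1 - t) * X \<omega> + t * Y \<omega>) \<le> (1 - t) * nrm X + t * nrm Y + e" .
qed

text \<open>Jensen's inequality for \<open>g\<close> at each admissible scale \<open>c\<close>:
  conditioning preserves the expectation of \<open>g (Y \<omega> / c)\<close>, so \<open>c\<close>
  stays admissible.\<close>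

lemma lux_cond_exp:
  assumes N: "subalgebra M N" and Y: "integrable M Y"
  shows "lux (real_cond_exp M N Y) \<le> lux Y"
proof (rule lux_le_luxI)
  interpret finite_measure_subalgebra M N by unfold_locales (rule N)
  have [measurable]: "Y \<in> borel_measurable M" using Y by auto
  fix c assume "lux Y < ereal c"
  note c = lux_lessD[OF this]
  have int: "integrable M (\<lambda>\<omega>. g (Y \<omega> / c))"
    using c(2) g_nonneg by (intro integrableI_nonneg) (auto intro: le_less_trans)
  have "convex_on UNIV (\<lambda>x. g (x / c))"
  proof (rule convex_onI)
    fix t x y :: real assume "0 < t" "t < 1"
    then show "g (((1 - t) *\<^sub>R x + t *\<^sub>R y) / c) \<le> (1 - t) * g (x / c) + t * g (y / c)"
      using convex_onD[OF g_convex, of t "x / c" "y / c"] by (simp add: add_divide_distrib)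
  qed simp
  then have jensen: "AE \<omega> in M. g (real_cond_exp M N Y \<omega> / c) \<le> real_cond_exp M N (\<lambda>\<omega>. g (Y \<omega> / c)) \<omega>"
    by (intro real_cond_exp_jensens_inequality(2)[OF Y _ _ int, of UNIV]) auto
  then have "(\<integral>\<^sup>+ \<omega>. ennreal (g (real_cond_exp M N Y \<omega> / c)) \<partial>M)
      \<le> (\<integral>\<^sup>+ \<omega>. ennreal (real_cond_exp M N (\<lambda>\<omega>. g (Y \<omega> / c)) \<omega>) \<partial>M)"
    by (intro nn_integral_mono_AE) (auto intro: ennreal_leI)
  also have "\<dots> = ennreal (\<integral>\<omega>. real_cond_exp M N (\<lambda>\<omega>. g (Y \<omega> / c)) \<omega> \<partial>M)"
    using jensen g_nonneg by (intro nn_integral_eq_integral real_cond_exp_int int) (auto intro: order_trans)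
  also have "\<dots> = ennreal (\<integral>\<omega>. g (Y \<omega> / c) \<partial>M)" by (simp add: real_cond_exp_int(2)[OF int])
  also have "\<dots> = (\<integral>\<^sup>+ \<omega>. ennreal (g (Y \<omega> / c)) \<partial>M)"
    using int g_nonneg by (intro nn_integral_eq_integral[symmetric]) auto
  also have "\<dots> \<le> 1" by (rule c(2))
  finally show "lux (real_cond_exp M N Y) \<le> ereal c" by (intro lux_leI c(1))
qed

text \<open>At every scale above the norm, \<open>g\<close> of \<open>k\<close> over that scale is
  at most 1, so this quotient is at most \<open>c\<^sub>0\<close>. Lower bounds for \<open>T\<close>
  on bounded variables are reduced to constants in this way.\<close>

lemma const_le_nrm:
  assumes X: "X \<in> bounded_rvs M" and k: "0 \<le> k" "AE \<omega> in M. k \<le> \<bar>X \<omega>\<bar>"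
  shows "k / c\<^sub>0 \<le> nrm X"
proof (rule field_le_epsilon)
  fix e :: real assume e: "0 < e"
  let ?c = "nrm X + e"
  have "lux X < ereal ?c" using e by (simp add: lux_nrm[OF X])
  note c = lux_lessD[OF this]
  have "ennreal (g (k / ?c)) = (\<integral>\<^sup>+ \<omega>. ennreal (g (k / ?c)) \<partial>M)" by (simp add: emeasure_space_1)
  also have "\<dots> \<le> (\<integral>\<^sup>+ \<omega>. ennreal (g (X \<omega> / ?c)) \<partial>M)"
    using k(2) by (intro nn_integral_mono_AE, eventually_elim)
      (use k(1) c(1) in \<open>auto intro!: ennreal_leI g_mono divide_right_mono simp: abs_divide\<close>)
  also note c(2)
  finally have "g (k / ?c) \<le> 1" by simp
  then have "k / ?c \<le> c\<^sub>0"
    using le_inverse_at_one[of "k / ?c"] k(1) c(1) inverse_at_one_pos by (cases "k = 0") auto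
  then show "k / c\<^sub>0 \<le> ?c" using c(1) inverse_at_one_pos by (simp add: field_simps)
qed

section \<open>The dual Orlicz space and Hoelder's inequality\<close>

abbreviation dual_space :: "('a \<Rightarrow> real) set" where
  "dual_space \<equiv> orlicz_space M (convex_conjugate_on {0..} G)"

lemma conjugate_mono: "y \<le> y' \<Longrightarrow> convex_conjugate_on {0..} G y \<le> convex_conjugate_on {0..} G y'"
  by (rule convex_conjugate_on_mono) simp_all

lemma conjugate_measurable[measurable]: "convex_conjugate_on {0..} G \<in> borel_measurable borel"
  by (intro borel_measurable_mono_ereal monoI conjugate_mono)

lemma conjugate_nonneg: "0 \<le> convex_conjugate_on {0..} G y"
proof -
  have "ereal (0 * y) - G 0 \<le> convex_conjugate_on {0..} G y"
    unfolding convex_conjugate_on_def by (rule SUP_upper) simp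
  then show ?thesis by (simp add: G_nonneg_arg g_zero)
qed

lemma orlicz_norm_nonneg: "0 \<le> orlicz_norm M G \<eta>"
proof -
  have "lux (\<lambda>_. 0) \<le> ereal 1" by (rule lux_leI) (simp_all add: g_zero)
  then have "ereal_expectation M (\<lambda>\<omega>. ereal (\<eta> \<omega> * 0)) \<le> orlicz_norm M G \<eta>"
    unfolding orlicz_norm_def by (intro SUP_upper) (simp add: one_ereal_def)
  then show ?thesis by (simp add: ereal_expectation_def zero_ennreal.rep_eq flip: zero_ereal_def)
qed

text \<open>Young's inequality for \<open>c * \<bar>\<eta> \<omega>\<bar>\<close> and
  \<open>\<bar>Y \<omega> / 2\<bar>\<close>. The number 2 lies strictly above the bound 1 on the
  norm of \<open>Y\<close>, so \<open>g (Y \<omega> / 2)\<close> has expectation at most 1; the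
  factor \<open>2 / c\<close> undoes both scalings.\<close>

lemma orlicz_norm_finite:
  assumes \<eta>: "\<eta> \<in> dual_space"
  shows "orlicz_norm M G \<eta> = ereal (real_of_ereal (orlicz_norm M G \<eta>))"
proof -
  have [measurable]: "\<eta> \<in> borel_measurable M" using orlicz_spaceD_integrable[OF \<eta>] by auto
  obtain c where c: "0 < c"
    and fin: "(\<integral>\<^sup>+ \<omega>. e2ennreal (convex_conjugate_on {0..} G (c * \<bar>\<eta> \<omega>\<bar>)) \<partial>M) < \<infinity>" (is "?I < _")
    using \<eta> by (auto simp: orlicz_space_def)
  let ?G = "\<lambda>\<omega>. e2ennreal (convex_conjugate_on {0..} G (c * \<bar>\<eta> \<omega>\<bar>))"
  have [measurable]: "?G \<in> borel_measurable M" by simp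
  have bound: "ereal_expectation M (\<lambda>\<omega>. ereal (\<eta> \<omega> * Y \<omega>)) \<le> enn2ereal (ennreal (2 / c) * (?I + 1))"
    if Y: "integrable M Y" "lux Y \<le> 1" for Y
  proof -
    have [measurable]: "Y \<in> borel_measurable M" using Y by auto
    have "lux Y < ereal 2" using Y(2) by (rule le_less_trans) (simp add: one_ereal_def)
    note Y2 = lux_lessD(2)[OF this]
    have "e2ennreal (ereal (\<eta> \<omega> * Y \<omega>)) \<le> ennreal (2 / c) * (?G \<omega> + ennreal (g (Y \<omega> / 2)))" for \<omega>
    proof -
      have "ereal (\<bar>Y \<omega> / 2\<bar> * (c * \<bar>\<eta> \<omega>\<bar>)) \<le> convex_conjugate_on {0..} G (c * \<bar>\<eta> \<omega>\<bar>) + G \<bar>Y \<omega> / 2\<bar>"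
        by (rule young_inequality) (auto simp: G_abs simp del: abs_divide)
      then have "e2ennreal (ereal (\<bar>Y \<omega> / 2\<bar> * (c * \<bar>\<eta> \<omega>\<bar>)))
          \<le> e2ennreal (convex_conjugate_on {0..} G (c * \<bar>\<eta> \<omega>\<bar>) + ereal (g (Y \<omega> / 2)))"
        unfolding G_abs by (rule e2ennreal_mono)
      also have "\<dots> = ?G \<omega> + ennreal (g (Y \<omega> / 2))"
        by (intro e2ennreal_add_ereal conjugate_nonneg g_nonneg)
      finally have "ennreal (2 / c) * ennreal (\<bar>Y \<omega> / 2\<bar> * (c * \<bar>\<eta> \<omega>\<bar>))
          \<le> ennreal (2 / c) * (?G \<omega> + ennreal (g (Y \<omega> / 2)))" by (simp add: mult_left_mono)
      moreover have "ennreal (2 / c) * ennreal (\<bar>Y \<omega> / 2\<bar> * (c * \<bar>\<eta> \<omega>\<bar>)) = ennreal \<bar>\<eta> \<omega> * Y \<omega>\<bar>"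
        using c by (simp flip: ennreal_mult add: abs_mult)
      moreover have "ennreal (\<eta> \<omega> * Y \<omega>) \<le> ennreal \<bar>\<eta> \<omega> * Y \<omega>\<bar>" by (rule ennreal_leI) simp
      ultimately show ?thesis unfolding e2ennreal_ereal by (metis order_trans)
    qed
    then have "(\<integral>\<^sup>+ \<omega>. e2ennreal (ereal (\<eta> \<omega> * Y \<omega>)) \<partial>M)
        \<le> (\<integral>\<^sup>+ \<omega>. ennreal (2 / c) * (?G \<omega> + ennreal (g (Y \<omega> / 2))) \<partial>M)"
      by (intro nn_integral_mono)
    also have "\<dots> = ennreal (2 / c) * (?I + (\<integral>\<^sup>+ \<omega>. ennreal (g (Y \<omega> / 2)) \<partial>M))"
      by (subst nn_integral_cmult, simp, subst nn_integral_add) simp_all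
    also have "\<dots> \<le> ennreal (2 / c) * (?I + 1)" by (intro mult_left_mono add_left_mono Y2) simp
    finally have "enn2ereal (\<integral>\<^sup>+ \<omega>. e2ennreal (ereal (\<eta> \<omega> * Y \<omega>)) \<partial>M) \<le> enn2ereal (ennreal (2 / c) * (?I + 1))"
      by (simp add: less_eq_ennreal.rep_eq)
    then show ?thesis by (rule order_trans[OF ereal_expectation_le_nn_integral])
  qed
  have "ennreal (2 / c) * (?I + 1) < \<infinity>" using fin by (simp add: ennreal_mult_less_top)
  then have "enn2ereal (ennreal (2 / c) * (?I + 1)) < \<infinity>"
    by (cases "ennreal (2 / c) * (?I + 1)") auto
  moreover have "orlicz_norm M G \<eta> \<le> enn2ereal (ennreal (2 / c) * (?I + 1))"
    unfolding orlicz_norm_def using bound by (intro SUP_least) auto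
  ultimately show ?thesis using orlicz_norm_nonneg[of \<eta>] by (cases "orlicz_norm M G \<eta>") auto
qed

lemma integrable_mult_bounded:
  assumes "integrable M X" "Y \<in> bounded_rvs M"
  shows "integrable M (\<lambda>\<omega>. X \<omega> * Y \<omega>)"
proof -
  obtain B where B: "0 < B" "AE \<omega> in M. \<bar>Y \<omega>\<bar> \<le> B" using assms(2) by (rule bounded_rvs_boundE)
  have [measurable]: "X \<in> borel_measurable M" "Y \<in> borel_measurable M"
    using assms by (auto intro: bounded_rvs_measurable)
  have bound: "AE \<omega> in M. norm (X \<omega> * Y \<omega>) \<le> norm (B * X \<omega>)"
    using B(2)
  proof eventually_elim
    case (elim \<omega>)
    then have "\<bar>Y \<omega>\<bar> * \<bar>X \<omega>\<bar> \<le> B * \<bar>X \<omega>\<bar>" by (rule mult_right_mono) simp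
    then show ?case using B(1) by (simp add: abs_mult mult.commute)
  qed
  have "integrable M (\<lambda>\<omega>. B * X \<omega>)" using assms(1) by simp
  moreover have "(\<lambda>\<omega>. X \<omega> * Y \<omega>) \<in> borel_measurable M" by simp
  ultimately show ?thesis using bound by (rule Bochner_Integration.integrable_bound)
qed

text \<open>Divided by a number above its norm, \<open>V\<close> competes in the supremum that
  defines the Orlicz norm. The slack \<open>e\<close> covers norm 0 and an infimum that is not
  attained.\<close>

lemma hoelder:
  assumes \<eta>: "\<eta> \<in> dual_space" and V: "V \<in> bounded_rvs M"
  shows "(\<integral>\<omega>. \<eta> \<omega> * V \<omega> \<partial>M) \<le> nrm V * real_of_ereal (orlicz_norm M G \<eta>)"
proof -
  define o' where "o' = real_of_ereal (orlicz_norm M G \<eta>)"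
  have o: "orlicz_norm M G \<eta> = ereal o'" unfolding o'_def by (rule orlicz_norm_finite[OF \<eta>])
  have o_nonneg: "0 \<le> o'" using orlicz_norm_nonneg[of \<eta>] by (simp add: o)
  have le: "(\<integral>\<omega>. \<eta> \<omega> * V \<omega> \<partial>M) \<le> (nrm V + e) * o'" if e: "0 < e" for e
  proof -
    let ?c = "nrm V + e"
    have "lux V < ereal ?c" using e by (simp add: lux_nrm[OF V])
    note c = lux_lessD[OF this]
    have Y: "(\<lambda>\<omega>. (1 / ?c) * V \<omega>) \<in> bounded_rvs M" using V by (rule bounded_rvs_cmult)
    have "lux (\<lambda>\<omega>. (1 / ?c) * V \<omega>) \<le> ereal 1" using c by (intro lux_leI) auto
    then have "ereal_expectation M (\<lambda>\<omega>. ereal (\<eta> \<omega> * ((1 / ?c) * V \<omega>))) \<le> orlicz_norm M G \<eta>"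
      unfolding orlicz_norm_def using bounded_rvs_integrable[OF Y]
      by (intro SUP_upper) (simp add: one_ereal_def)
    also have "ereal_expectation M (\<lambda>\<omega>. ereal (\<eta> \<omega> * ((1 / ?c) * V \<omega>)))
        = ereal (\<integral>\<omega>. \<eta> \<omega> * ((1 / ?c) * V \<omega>) \<partial>M)"
      by (intro ereal_expectation_real integrable_mult_bounded orlicz_spaceD_integrable[OF \<eta>] Y) simp
    also have "(\<integral>\<omega>. \<eta> \<omega> * ((1 / ?c) * V \<omega>) \<partial>M) = (\<integral>\<omega>. \<eta> \<omega> * V \<omega> \<partial>M) / ?c" by simp
    finally show ?thesis using c(1) by (simp add: o field_simps)
  qed
  have "(\<integral>\<omega>. \<eta> \<omega> * V \<omega> \<partial>M) \<le> nrm V * o'"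
  proof (rule field_le_epsilon)
    fix e :: real assume e: "0 < e"
    have "(\<integral>\<omega>. \<eta> \<omega> * V \<omega> \<partial>M) \<le> (nrm V + e / (o' + 1)) * o'"
      using e o_nonneg by (intro le) auto
    also have "\<dots> = nrm V * o' + e * (o' / (o' + 1))" by (simp add: algebra_simps)
    also have "\<dots> \<le> nrm V * o' + e * 1"
      using e o_nonneg by (intro add_left_mono mult_left_mono) auto
    finally show "(\<integral>\<omega>. \<eta> \<omega> * V \<omega> \<partial>M) \<le> nrm V * o' + e" by simp
  qed
  then show ?thesis by (simp add: o'_def)
qed

text \<open>The conjugate of \<open>G\<close> may be infinite far from 0, but it is finite at the
  secant slope \<open>a\<close>: beyond \<open>x\<^sub>1\<close> the line through 0 of slope
  \<open>a\<close> stays below \<open>g\<close>. The scaling \<open>a / B\<close> brings a variable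
  bounded by \<open>B\<close> into that range.\<close>

lemma bounded_rvs_subset_dual_space: "bounded_rvs M \<subseteq> dual_space"
proof
  fix \<eta> assume \<eta>: "\<eta> \<in> bounded_rvs M"
  obtain x\<^sub>1 where x\<^sub>1: "0 < x\<^sub>1" "1 < g x\<^sub>1" by (rule g_unbounded)
  define a where "a = g x\<^sub>1 / x\<^sub>1"
  have a: "0 < a" using x\<^sub>1 by (simp add: a_def)
  have "ereal (x * a) - G x \<le> ereal (a * x\<^sub>1)" if "0 \<le> x" for x
  proof -
    have "a * x - g x \<le> a * x\<^sub>1"
    proof (cases "x\<^sub>1 \<le> x")
      case True
      then show ?thesis
        using convex_on_secant_minorant[OF g_convex_nonneg x\<^sub>1(1) True] mult_pos_pos[OF a x\<^sub>1(1)]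
        by (simp add: a_def g_zero)
    next
      case False
      then have "a * x \<le> a * x\<^sub>1" using a by simp
      then show ?thesis using g_nonneg[of x] by simp
    qed
    then show ?thesis using that by (simp add: G_nonneg_arg mult.commute)
  qed
  then have conj_a: "convex_conjugate_on {0..} G a \<le> ereal (a * x\<^sub>1)"
    unfolding convex_conjugate_on_def by (intro SUP_least) auto
  obtain B where B: "0 < B" "AE \<omega> in M. \<bar>\<eta> \<omega>\<bar> \<le> B" using \<eta> by (rule bounded_rvs_boundE)
  have "AE \<omega> in M. e2ennreal (convex_conjugate_on {0..} G (a / B * \<bar>\<eta> \<omega>\<bar>)) \<le> ennreal (a * x\<^sub>1)"
    using B(2)
  proof eventually_elim
    case (elim \<omega>)
    then have "a / B * \<bar>\<eta> \<omega>\<bar> \<le> a" using a B(1) by (simp add: field_simps)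
    from e2ennreal_mono[OF order_trans[OF conjugate_mono[OF this] conj_a]] show ?case by simp
  qed
  then have "(\<integral>\<^sup>+ \<omega>. e2ennreal (convex_conjugate_on {0..} G (a / B * \<bar>\<eta> \<omega>\<bar>)) \<partial>M) \<le> (\<integral>\<^sup>+ \<omega>. ennreal (a * x\<^sub>1) \<partial>M)"
    by (rule nn_integral_mono_AE)
  also have "\<dots> < \<infinity>" by (simp add: emeasure_space_1)
  finally show "\<eta> \<in> dual_space"
    using a B(1) bounded_rvs_integrable[OF \<eta>] by (auto simp: orlicz_space_def intro!: exI[of _ "a / B"])
qed

end

section \<open>Conditioning on finite partitions\<close>

text \<open>Coordinates for the variables that are constant on blocks. As a sum, measurability and
  expectation are obtained term by term.\<close>

definition step_rv :: "'a set set \<Rightarrow> ('a set \<Rightarrow> real) \<Rightarrow> 'a \<Rightarrow> real" where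
  "step_rv \<pi> u \<omega> = (\<Sum>A\<in>\<pi>. u A * indicator A \<omega>)"

context prob_space
begin

lemma finite_partitionsD:
  assumes "\<pi> \<in> finite_partitions M"
  shows "finite \<pi>" "\<pi> \<subseteq> sets M" "\<Union>\<pi> = space M" "A \<in> \<pi> \<Longrightarrow> B \<in> \<pi> \<Longrightarrow> A \<noteq> B \<Longrightarrow> A \<inter> B = {}"
    "A \<in> \<pi> \<Longrightarrow> 0 < prob A"
proof -
  show "finite \<pi>" "\<pi> \<subseteq> sets M" "\<Union>\<pi> = space M" "A \<in> \<pi> \<Longrightarrow> B \<in> \<pi> \<Longrightarrow> A \<noteq> B \<Longrightarrow> A \<inter> B = {}"
    using assms by (auto simp: finite_partitions_def partition_on_def disjoint_def)
  show "A \<in> \<pi> \<Longrightarrow> 0 < prob A"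
    using assms by (simp add: finite_partitions_def emeasure_eq_measure zero_less_measure_iff)
qed

lemma step_rv_eq:
  assumes \<pi>: "\<pi> \<in> finite_partitions M" and A: "A \<in> \<pi>" "\<omega> \<in> A"
  shows "step_rv \<pi> u \<omega> = u A"
proof -
  have "indicator B \<omega> = (0::real)" if "B \<in> \<pi> - {A}" for B
    using finite_partitionsD(4)[OF \<pi> A(1), of B] A(2) that by (auto simp: indicator_def)
  then show ?thesis
    unfolding step_rv_def using A by (simp add: sum.remove[OF finite_partitionsD(1)[OF \<pi>] A(1)])
qed

lemma block_exists:
  assumes "\<pi> \<in> finite_partitions M" "\<omega> \<in> space M"
  obtains A where "A \<in> \<pi>" "\<omega> \<in> A"
  using assms finite_partitionsD(3) by blast

lemma step_rv_compose:
  assumes "\<pi> \<in> finite_partitions M" "\<omega> \<in> space M"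
  shows "f (step_rv \<pi> u \<omega>) = step_rv \<pi> (\<lambda>A. f (u A)) \<omega>"
  by (rule block_exists[OF assms]) (simp add: step_rv_eq[OF assms(1)])

lemma step_rv_compose2:
  assumes "\<pi> \<in> finite_partitions M" "\<omega> \<in> space M"
  shows "f (step_rv \<pi> u \<omega>) (step_rv \<pi> v \<omega>) = step_rv \<pi> (\<lambda>A. f (u A) (v A)) \<omega>"
  by (rule block_exists[OF assms]) (simp add: step_rv_eq[OF assms(1)])

lemma subalgebra_partition:
  assumes \<pi>: "\<pi> \<in> finite_partitions M"
  shows "subalgebra M (sigma (space M) \<pi>)"
  unfolding subalgebra_def
  using finite_partitionsD(2)[OF \<pi>] sets.sets_into_space
  by (auto simp: space_measure_of_conv sets_measure_of_conv intro: sets.sigma_sets_subset[THEN subsetD])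

lemma step_rv_measurable_sigma:
  assumes \<pi>: "\<pi> \<in> finite_partitions M"
  shows "step_rv \<pi> u \<in> borel_measurable (sigma (space M) \<pi>)"
proof -
  have "\<pi> \<subseteq> Pow (space M)" using finite_partitionsD(2)[OF \<pi>] sets.sets_into_space by auto
  then have "A \<in> sets (sigma (space M) \<pi>)" if "A \<in> \<pi>" for A
    using that by auto
  then show ?thesis unfolding step_rv_def[abs_def] by (intro borel_measurable_sum) auto
qed

lemma step_rv_measurable:
  assumes "\<pi> \<in> finite_partitions M" shows "step_rv \<pi> u \<in> borel_measurable M"
  using measurable_from_subalg[OF subalgebra_partition[OF assms] step_rv_measurable_sigma[OF assms]] .

lemma step_rv_simple:
  assumes \<pi>: "\<pi> \<in> finite_partitions M" shows "step_rv \<pi> u \<in> simple_rvs M"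
proof -
  have "step_rv \<pi> u ` space M \<subseteq> u ` \<pi>"
    using step_rv_eq[OF \<pi>] by (auto elim!: block_exists[OF \<pi>])
  then have "finite (step_rv \<pi> u ` space M)"
    using finite_partitionsD(1)[OF \<pi>] by (meson finite_imageI finite_subset)
  then have "simple_function M (step_rv \<pi> u)"
    using step_rv_measurable[OF \<pi>] by (simp add: simple_function_borel_measurable)
  then show ?thesis using step_rv_measurable[OF \<pi>] by (auto simp: simple_rvs_def)
qed

lemma step_rv_bounded: "\<pi> \<in> finite_partitions M \<Longrightarrow> step_rv \<pi> u \<in> bounded_rvs M"
  using step_rv_simple simple_rvs_subset_bounded_rvs by blast

lemma integral_step_rv:
  assumes \<pi>: "\<pi> \<in> finite_partitions M"
  shows "(\<integral>\<omega>. step_rv \<pi> u \<omega> \<partial>M) = (\<Sum>A\<in>\<pi>. prob A * u A)"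
proof -
  have sets: "A \<in> sets M" if "A \<in> \<pi>" for A using finite_partitionsD(2)[OF \<pi>] that by auto
  then have "(\<integral>\<omega>. step_rv \<pi> u \<omega> \<partial>M) = (\<Sum>A\<in>\<pi>. \<integral>\<omega>. u A * indicator A \<omega> \<partial>M)"
    unfolding step_rv_def by (intro Bochner_Integration.integral_sum) (simp add: emeasure_eq_measure)
  also have "\<dots> = (\<Sum>A\<in>\<pi>. prob A * u A)"
  proof (rule sum.cong[OF refl])
    fix A assume "A \<in> \<pi>"
    then have "A \<inter> space M = A" using sets sets.sets_into_space by auto
    then show "(\<integral>\<omega>. u A * indicator A \<omega> \<partial>M) = prob A * u A" by simp
  qed
  finally show ?thesis .
qed

lemma integral_step_rv_mult:
  assumes "\<pi> \<in> finite_partitions M"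
  shows "(\<integral>\<omega>. step_rv \<pi> u \<omega> * step_rv \<pi> v \<omega> \<partial>M) = (\<Sum>A\<in>\<pi>. prob A * u A * v A)"
proof -
  have "(\<integral>\<omega>. step_rv \<pi> u \<omega> * step_rv \<pi> v \<omega> \<partial>M) = (\<integral>\<omega>. step_rv \<pi> (\<lambda>A. u A * v A) \<omega> \<partial>M)"
    by (intro Bochner_Integration.integral_cong refl step_rv_compose2 assms)
  then show ?thesis by (simp add: integral_step_rv[OF assms] mult.assoc)
qed

lemma partition_prob_sum: "\<pi> \<in> finite_partitions M \<Longrightarrow> (\<Sum>A\<in>\<pi>. prob A) = 1"
proof -
  assume \<pi>: "\<pi> \<in> finite_partitions M"
  have "(\<integral>\<omega>. step_rv \<pi> (\<lambda>_. 1) \<omega> \<partial>M) = (\<integral>\<omega>. (1::real) \<partial>M)"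
    by (intro Bochner_Integration.integral_cong refl) (auto elim!: block_exists[OF \<pi>] simp: step_rv_eq[OF \<pi>])
  then show ?thesis using \<pi> by (simp add: integral_step_rv prob_space)
qed

text \<open>A set of the generated \<sigma>-algebra contains or misses each block, so a function
  measurable for it is constant on blocks. Hence the equality holds everywhere on the space, not
  just almost surely.\<close>

lemma partition_cond_exp_step:
  assumes \<pi>: "\<pi> \<in> finite_partitions M"
  obtains w where "\<And>\<omega>. \<omega> \<in> space M \<Longrightarrow> partition_cond_exp M \<pi> X \<omega> = step_rv \<pi> w \<omega>"
proof -
  let ?N = "sigma (space M) \<pi>" and ?Y = "partition_cond_exp M \<pi> X"
  have Pow: "\<pi> \<subseteq> Pow (space M)" using finite_partitionsD(2)[OF \<pi>] sets.sets_into_space by auto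
  have space: "space ?N = space M" by (simp add: space_measure_of_conv)
  have atom: "A \<inter> S = {} \<or> A \<subseteq> S" if "S \<in> sigma_sets (space M) \<pi>" "A \<in> \<pi>" for S A
    using that(1)
  proof induction
    case (Basic B)
    then show ?case using finite_partitionsD(4)[OF \<pi> \<open>A \<in> \<pi>\<close>] by (cases "A = B") auto
  next
    case (Compl B)
    then show ?case using Pow \<open>A \<in> \<pi>\<close> by blast
  qed auto
  have const: "?Y x = ?Y y" if "A \<in> \<pi>" "x \<in> A" "y \<in> A" for A x y
  proof -
    have "?Y \<in> borel_measurable ?N"
      unfolding partition_cond_exp_def by (rule borel_measurable_cond_exp)
    then have "?Y -` {?Y x} \<inter> space ?N \<in> sets ?N" by (rule measurable_sets) simp
    then have "A \<subseteq> ?Y -` {?Y x} \<inter> space M \<or> A \<inter> (?Y -` {?Y x} \<inter> space M) = {}"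
      using atom[OF _ \<open>A \<in> \<pi>\<close>] sets_measure_of[OF Pow] by (auto simp: space)
    then show ?thesis using that Pow by auto
  qed
  show thesis
  proof (rule that[of "\<lambda>A. ?Y (SOME x. x \<in> A)"])
    fix \<omega> assume "\<omega> \<in> space M"
    then obtain A where A: "A \<in> \<pi>" "\<omega> \<in> A" using block_exists[OF \<pi>] by blast
    then have "?Y \<omega> = ?Y (SOME x. x \<in> A)" by (intro const[OF A]) (rule someI)
    then show "?Y \<omega> = step_rv \<pi> (\<lambda>A. ?Y (SOME x. x \<in> A)) \<omega>" by (simp add: step_rv_eq[OF \<pi> A])
  qed
qed

text \<open>A weight that is constant on blocks cannot distinguish \<open>X\<close> from its
  conditional expectation.\<close>

lemma partition_cond_exp_integral:
  assumes \<pi>: "\<pi> \<in> finite_partitions M" and X: "integrable M X"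
  shows "(\<integral>\<omega>. step_rv \<pi> z \<omega> * partition_cond_exp M \<pi> X \<omega> \<partial>M) = (\<integral>\<omega>. step_rv \<pi> z \<omega> * X \<omega> \<partial>M)"
proof -
  interpret finite_measure_subalgebra M "sigma (space M) \<pi>"
    by unfold_locales (rule subalgebra_partition[OF \<pi>])
  have int: "integrable M (\<lambda>\<omega>. step_rv \<pi> z \<omega> * X \<omega>)"
    unfolding step_rv_def[abs_def] sum_distrib_right
  proof (rule Bochner_Integration.integrable_sum)
    fix A assume "A \<in> \<pi>"
    then have "A \<in> sets M" using finite_partitionsD(2)[OF \<pi>] by auto
    then have "integrable M (\<lambda>\<omega>. z A * (X \<omega> * indicator A \<omega>))"
      by (intro integrable_mult_right integrable_real_mult_indicator X)
    then show "integrable M (\<lambda>\<omega>. z A * indicator A \<omega> * X \<omega>)" by (simp add: ac_simps)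
  qed
  show ?thesis
    unfolding partition_cond_exp_def
    using X by (intro real_cond_exp_intg(2) int step_rv_measurable_sigma[OF \<pi>]) auto
qed

lemma simple_rvs_step:
  assumes "Z \<in> simple_rvs M"
  obtains \<pi> z where "\<pi> \<in> finite_partitions M" "AE \<omega> in M. Z \<omega> = step_rv \<pi> z \<omega>"
proof -
  obtain Z' where Z': "simple_function M Z'" and ZZ': "AE \<omega> in M. Z \<omega> = Z' \<omega>"
    using assms by (auto simp: simple_rvs_def)
  define L where "L v = Z' -` {v} \<inter> space M" for v
  have fin: "finite (Z' ` space M)" using Z' by (rule simple_functionD)
  have L[measurable]: "L v \<in> sets M" for v using Z' unfolding L_def by (rule simple_functionD)
  define V where "V = {v \<in> Z' ` space M. 0 < prob (L v)}"
  have finV: "finite V" using fin by (simp add: V_def)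
  have AE_V: "AE \<omega> in M. Z' \<omega> \<in> V"
  proof -
    have "AE \<omega> in M. \<forall>v\<in>Z' ` space M - V. \<omega> \<notin> L v"
    proof (rule AE_finite_allI)
      fix v assume "v \<in> Z' ` space M - V"
      then have "prob (L v) = 0" by (auto simp: V_def zero_less_measure_iff)
      then show "AE \<omega> in M. \<omega> \<notin> L v" by (intro AE_not_in) (simp add: null_sets_def emeasure_eq_measure)
    qed (use fin in simp)
    then show ?thesis using AE_space by eventually_elim (auto simp: L_def)
  qed
  then have "V \<noteq> {}" using AE_False by auto
  then obtain v\<^sub>0 where v\<^sub>0: "v\<^sub>0 \<in> V" by auto
  \<comment> \<open>Blocks must have positive probability. Points whose value has probability 0 are
    therefore moved to the value \<open>v\<^sub>0\<close>; this alters \<open>Z'\<close> on a null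
    set only, and every level set of \<open>\<kappa>\<close> over \<open>V\<close> becomes a
    legitimate block.\<close>
  define \<kappa> where "\<kappa> \<omega> = (if Z' \<omega> \<in> V then Z' \<omega> else v\<^sub>0)" for \<omega>
  define K where "K v = \<kappa> -` {v} \<inter> space M" for v
  have \<kappa>V: "\<kappa> \<omega> \<in> V" for \<omega> using v\<^sub>0 by (simp add: \<kappa>_def)
  have K[measurable]: "K v \<in> sets M" for v
  proof -
    have "simple_function M (\<lambda>\<omega>. (\<lambda>y. if y \<in> V then y else v\<^sub>0) (Z' \<omega>))"
      by (rule simple_function_compose1[OF Z'])
    then have "simple_function M \<kappa>" by (simp add: \<kappa>_def[abs_def])
    then show ?thesis unfolding K_def by (rule simple_functionD)
  qed
  have pos: "0 < prob (K v)" if "v \<in> V" for v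
  proof -
    have "L v \<subseteq> K v" using that by (auto simp: L_def K_def \<kappa>_def)
    then have "prob (L v) \<le> prob (K v)" by (intro finite_measure_mono) auto
    then show ?thesis using that by (simp add: V_def)
  qed
  define \<pi> where "\<pi> = K ` V"
  have \<pi>: "\<pi> \<in> finite_partitions M"
    unfolding finite_partitions_def
  proof (intro CollectI conjI ballI)
    show "finite \<pi>" using finV by (simp add: \<pi>_def)
    show "partition_on (space M) \<pi>"
    proof (rule partition_onI)
      show "\<Union>\<pi> = space M" using \<kappa>V by (auto simp: \<pi>_def K_def)
    next
      fix A B assume "A \<in> \<pi>" "B \<in> \<pi>" "A \<noteq> B"
      then show "disjnt A B" by (auto simp: \<pi>_def K_def disjnt_def)
    next
      show "{} \<notin> \<pi>" using pos by (force simp: \<pi>_def)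
    qed
    fix A assume "A \<in> \<pi>"
    then show "A \<in> sets M" "emeasure M A \<noteq> 0"
      using pos by (force simp: \<pi>_def emeasure_eq_measure)+
  qed
  have step: "step_rv \<pi> (\<lambda>A. \<kappa> (SOME x. x \<in> A)) \<omega> = \<kappa> \<omega>" if "\<omega> \<in> space M" for \<omega>
  proof -
    have \<omega>: "K (\<kappa> \<omega>) \<in> \<pi>" "\<omega> \<in> K (\<kappa> \<omega>)" using \<kappa>V that by (auto simp: \<pi>_def K_def)
    have "(SOME x. x \<in> K (\<kappa> \<omega>)) \<in> K (\<kappa> \<omega>)" using \<omega>(2) by (rule someI)
    then show ?thesis by (simp add: step_rv_eq[OF \<pi> \<omega>]) (simp add: K_def)
  qed
  have "AE \<omega> in M. Z \<omega> = step_rv \<pi> (\<lambda>A. \<kappa> (SOME x. x \<in> A)) \<omega>"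
    using ZZ' AE_V AE_space by eventually_elim (use step in \<open>auto simp: \<kappa>_def\<close>)
  with \<pi> show thesis by (rule that)
qed

end

section \<open>Transformed norm risk measures on bounded random variables\<close>

locale tnrm_setting = real_orlicz M G for M :: "'a measure" and G +
  fixes F :: "real \<Rightarrow> ereal" and H :: "real \<Rightarrow> real"
  assumes F_gt_MInf: "\<forall>x\<ge>0. - \<infinity> < F x"
    and F_increasing: "\<forall>x y. 0 \<le> x \<and> x \<le> y \<longrightarrow> F x \<le> F y"
    and F_convex: "ereal_convex_on {0..} F"
    and H_nonneg: "\<forall>x. 0 \<le> H x"
    and H_increasing: "mono H"
    and H_convex: "convex_on UNIV H"
    and H_lim: "filterlim H at_top at_top"
    and FGH1: "\<exists>s. \<exists>\<epsilon>>0. F ((H s + \<epsilon>) / inverse_at_one G) < \<infinity>"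
    and FGH2: "((\<lambda>s. F (H s) - ereal (inverse_at_one G * s)) \<longlongrightarrow> \<infinity>) at_top"
begin

text \<open>The convex increasing functional behind \<open>T\<close>, which is the infimum over
  \<open>s\<close> of the loss of \<open>s - X\<close> minus \<open>s\<close>. Convexity,
  monotonicity and the effect of conditioning are proved for it, before any infimum is
  taken.\<close>

definition loss :: "('a \<Rightarrow> real) \<Rightarrow> ereal" where
  "loss U = F (nrm (\<lambda>\<omega>. H (U \<omega>)))"

lemma tnrm_eq: "tnrm M F G H X = (INF s. loss (\<lambda>\<omega>. s - X \<omega>) - ereal s)"
  by (simp add: tnrm_def loss_def nrm_def)

lemma H_bounded_rvs: "U \<in> bounded_rvs M \<Longrightarrow> (\<lambda>\<omega>. H (U \<omega>)) \<in> bounded_rvs M"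
  using H_increasing by (rule bounded_rvs_mono_compose)

lemma F_nrm_gt: "- \<infinity> < F (nrm X)"
  using F_gt_MInf nrm_nonneg by auto

lemma F_mono: "0 \<le> x \<Longrightarrow> x \<le> y \<Longrightarrow> F x \<le> F y"
  using F_increasing by auto

lemma F_convex_le:
  assumes "0 \<le> x" "0 \<le> y" "0 \<le> t" "t \<le> 1" "F x \<le> ereal a" "F y \<le> ereal b"
  shows "F ((1 - t) * x + t * y) \<le> ereal ((1 - t) * a + t * b)"
proof -
  have "F ((1 - t) * x + t * y) \<le> ereal (1 - t) * F x + ereal t * F y"
    using F_convex assms unfolding ereal_convex_on_def by auto
  also have "\<dots> \<le> ereal (1 - t) * ereal a + ereal t * ereal b"
    using assms by (intro add_mono ereal_mult_left_mono) auto
  finally show ?thesis by simp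
qed

lemma H_convexD: "0 \<le> t \<Longrightarrow> t \<le> 1 \<Longrightarrow> H ((1 - t) * x + t * y) \<le> (1 - t) * H x + t * H y"
  using convex_onD[OF H_convex, of t x y] by simp

lemma loss_mono:
  assumes "U \<in> bounded_rvs M" "V \<in> bounded_rvs M" "AE \<omega> in M. U \<omega> \<le> V \<omega>"
  shows "loss U \<le> loss V"
  unfolding loss_def
proof (intro F_mono nrm_nonneg nrm_mono H_bounded_rvs assms(1,2))
  show "AE \<omega> in M. \<bar>H (U \<omega>)\<bar> \<le> \<bar>H (V \<omega>)\<bar>"
    using assms(3) by eventually_elim (use H_nonneg in \<open>auto intro: monoD[OF H_increasing]\<close>)
qed

lemma loss_convex_le:
  assumes U: "U \<in> bounded_rvs M" and V: "V \<in> bounded_rvs M" and t: "0 \<le> t" "t \<le> 1"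
    and ab: "loss U \<le> ereal a" "loss V \<le> ereal b"
  shows "loss (\<lambda>\<omega>. (1 - t) * U \<omega> + t * V \<omega>) \<le> ereal ((1 - t) * a + t * b)"
proof -
  note HU = H_bounded_rvs[OF U] and HV = H_bounded_rvs[OF V]
  have H_le: "\<bar>H ((1 - t) * U \<omega> + t * V \<omega>)\<bar> \<le> \<bar>(1 - t) * H (U \<omega>) + t * H (V \<omega>)\<bar>" for \<omega>
    using H_convexD[OF t, of "U \<omega>" "V \<omega>"] H_nonneg by auto
  have "nrm (\<lambda>\<omega>. H ((1 - t) * U \<omega> + t * V \<omega>)) \<le> nrm (\<lambda>\<omega>. (1 - t) * H (U \<omega>) + t * H (V \<omega>))"
    by (intro nrm_mono H_bounded_rvs bounded_rvs_add bounded_rvs_cmult U V HU HV AE_I2 H_le)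
  also have "\<dots> \<le> (1 - t) * nrm (\<lambda>\<omega>. H (U \<omega>)) + t * nrm (\<lambda>\<omega>. H (V \<omega>))"
    by (rule nrm_convex[OF HU HV t])
  finally have "loss (\<lambda>\<omega>. (1 - t) * U \<omega> + t * V \<omega>)
      \<le> F ((1 - t) * nrm (\<lambda>\<omega>. H (U \<omega>)) + t * nrm (\<lambda>\<omega>. H (V \<omega>)))"
    unfolding loss_def by (intro F_mono nrm_nonneg)
  also have "\<dots> \<le> ereal ((1 - t) * a + t * b)"
    using ab by (intro F_convex_le nrm_nonneg t) (auto simp: loss_def)
  finally show ?thesis .
qed

text \<open>Jensen's inequality enters twice, for \<open>H\<close> pointwise and for
  \<open>g\<close> inside the norm; monotonicity of the norm and of \<open>F\<close> joins the
  two.\<close>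

lemma loss_cond_exp:
  assumes \<pi>: "\<pi> \<in> finite_partitions M" and U: "U \<in> bounded_rvs M"
  shows "loss (partition_cond_exp M \<pi> U) \<le> loss U"
proof -
  note sub = subalgebra_partition[OF \<pi>]
  interpret finite_measure_subalgebra M "sigma (space M) \<pi>" by unfold_locales (rule sub)
  let ?E = "real_cond_exp M (sigma (space M) \<pi>)"
  have [measurable]: "H \<in> borel_measurable borel" using H_increasing by (rule borel_measurable_mono)
  have EU: "?E U \<in> bounded_rvs M"
    using partition_cond_exp_simple[OF \<pi>, of U] simple_rvs_subset_bounded_rvs[of M]
    unfolding partition_cond_exp_def by blast
  have int: "integrable M U" "integrable M (\<lambda>\<omega>. H (U \<omega>))"
    by (intro bounded_rvs_integrable H_bounded_rvs U)+
  have "AE \<omega> in M. H (?E U \<omega>) \<le> ?E (\<lambda>\<omega>. H (U \<omega>)) \<omega>"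
    by (intro real_cond_exp_jensens_inequality(2)[OF int(1) _ _ int(2), of UNIV] H_convex) auto
  then have "AE \<omega> in M. \<bar>H (?E U \<omega>)\<bar> \<le> \<bar>?E (\<lambda>\<omega>. H (U \<omega>)) \<omega>\<bar>"
    by eventually_elim (use H_nonneg in auto)
  then have "lux (\<lambda>\<omega>. H (?E U \<omega>)) \<le> lux (?E (\<lambda>\<omega>. H (U \<omega>)))" by (rule lux_mono)
  also have "\<dots> \<le> lux (\<lambda>\<omega>. H (U \<omega>))" by (rule lux_cond_exp[OF sub int(2)])
  finally have "nrm (\<lambda>\<omega>. H (?E U \<omega>)) \<le> nrm (\<lambda>\<omega>. H (U \<omega>))"
    by (simp add: lux_nrm[OF H_bounded_rvs[OF EU]] lux_nrm[OF H_bounded_rvs[OF U]])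
  then show ?thesis unfolding loss_def partition_cond_exp_def by (intro F_mono nrm_nonneg)
qed

section \<open>Finiteness of the risk measure from FGH1 and FGH2\<close>

lemma slater_point:
  obtains s \<epsilon> K where "0 < \<epsilon>" "F ((H s + \<epsilon>) / c\<^sub>0) = ereal K"
proof -
  obtain s \<epsilon> where s: "0 < \<epsilon>" "F ((H s + \<epsilon>) / c\<^sub>0) < \<infinity>" using FGH1 by auto
  have "0 \<le> (H s + \<epsilon>) / c\<^sub>0" using s H_nonneg inverse_at_one_pos by (simp add: less_imp_le add_nonneg_pos)
  then have "- \<infinity> < F ((H s + \<epsilon>) / c\<^sub>0)" using F_gt_MInf by blast
  then show thesis using s that by (cases "F ((H s + \<epsilon>) / c\<^sub>0)") auto
qed

lemma loss_finite: "\<exists>s K. \<forall>U. (AE \<omega> in M. U \<omega> \<le> s) \<longrightarrow> loss U \<le> ereal K"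
proof -
  obtain s \<epsilon> K where s: "0 < \<epsilon>" "F ((H s + \<epsilon>) / c\<^sub>0) = ereal K" by (rule slater_point)
  have "loss U \<le> ereal K" if "AE \<omega> in M. U \<omega> \<le> s" for U
    unfolding loss_def s(2)[symmetric]
  proof (intro F_mono nrm_nonneg nrm_bound)
    \<comment> \<open>The norm bound needs a positive constant, while \<open>H s\<close> may be 0;
      the \<epsilon> of FGH1 supplies the margin.\<close>
    show "0 < H s + \<epsilon>" using H_nonneg s(1) by (simp add: add_nonneg_pos)
    show "AE \<omega> in M. \<bar>H (U \<omega>)\<bar> \<le> H s + \<epsilon>"
      using that
    proof eventually_elim
      case (elim \<omega>)
      then show ?case using monoD[OF H_increasing elim] H_nonneg s(1) by auto
    qed
  qed
  then show ?thesis by blast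
qed

text \<open>The right-hand side is the loss of the constant \<open>s\<close>, so this bounds
  \<open>T\<close> from below on constants. If \<open>F\<close> takes the value \<infinity>, the
  claim is immediate for large \<open>s\<close> because \<open>H\<close> is unbounded; otherwise
  \<open>convex_composition_rescaled_bounded_below\<close> moves the factor \<open>c\<^sub>0\<close>
  of FGH2.\<close>

lemma loss_const_bounded_below: "\<exists>K. \<forall>s. ereal (K + s) \<le> F (H s / c\<^sub>0)"
proof -
  have nonneg: "0 \<le> H s / c\<^sub>0" for s using H_nonneg inverse_at_one_pos by simp
  have "\<exists>K s\<^sub>1. \<forall>s\<ge>s\<^sub>1. ereal (K + s) \<le> F (H s / c\<^sub>0)"
  proof (cases "\<exists>x\<ge>0. F x = \<infinity>")
    case True
    then obtain x where x: "0 \<le> x" "F x = \<infinity>" by auto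
    have "eventually (\<lambda>s. x * c\<^sub>0 \<le> H s) at_top" using H_lim by (simp add: filterlim_at_top)
    then obtain s\<^sub>1 where s\<^sub>1: "\<And>s. s\<^sub>1 \<le> s \<Longrightarrow> x * c\<^sub>0 \<le> H s" by (auto simp: eventually_at_top_linorder)
    have "F (H s / c\<^sub>0) = \<infinity>" if "s\<^sub>1 \<le> s" for s
    proof -
      have "x \<le> H s / c\<^sub>0" using s\<^sub>1[OF that] inverse_at_one_pos by (simp add: field_simps)
      then show ?thesis using F_mono[OF x(1)] x(2) by force
    qed
    then show ?thesis by (intro exI[of _ 0] exI[of _ s\<^sub>1]) auto
  next
    case False
    define f where "f x = real_of_ereal (F x)" for x
    have F: "F x = ereal (f x)" if "0 \<le> x" for x
    proof -
      have "F x \<noteq> \<infinity>" "- \<infinity> < F x" using False F_gt_MInf that by auto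
      then show ?thesis by (cases "F x") (auto simp: f_def)
    qed
    have "convex_on {0..} f"
    proof (rule convex_onI)
      fix t x y :: real assume t: "0 < t" "t < 1" and xy: "x \<in> {0..}" "y \<in> {0..}"
      then have "F ((1 - t) * x + t * y) \<le> ereal ((1 - t) * f x + t * f y)"
        by (intro F_convex_le) (auto simp: F)
      then show "f ((1 - t) *\<^sub>R x + t *\<^sub>R y) \<le> (1 - t) * f x + t * f y" using t xy by (simp add: F)
    qed simp
    moreover have "f x \<le> f y" if "0 \<le> x" "x \<le> y" for x y
      using F_mono[OF that] that by (simp add: F)
    moreover have "convex_on {0..} H" using H_convex by (rule convex_on_subset) auto
    moreover have "filterlim (\<lambda>s. f (H s) - c\<^sub>0 * s) at_top at_top"
      using FGH2 H_nonneg by (simp add: F tendsto_PInfty_eq_at_top)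
    ultimately have "\<exists>K s\<^sub>1. \<forall>s\<ge>s\<^sub>1. K \<le> f (H s / c\<^sub>0) - s"
      using H_nonneg H_lim inverse_at_one_pos
      by (intro convex_composition_rescaled_bounded_below) auto
    then obtain K s\<^sub>1 where "\<And>s. s\<^sub>1 \<le> s \<Longrightarrow> K \<le> f (H s / c\<^sub>0) - s" by auto
    then have "\<forall>s\<ge>s\<^sub>1. ereal (K + s) \<le> F (H s / c\<^sub>0)"
      using nonneg by (auto simp: F algebra_simps)
    then show ?thesis by blast
  qed
  then obtain K s\<^sub>1 where K: "\<And>s. s\<^sub>1 \<le> s \<Longrightarrow> ereal (K + s) \<le> F (H s / c\<^sub>0)" by auto
  obtain k where k: "ereal k \<le> F 0"
  proof (cases "F 0")
    case (real r)
    then show ?thesis using that[of r] by simp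
  next
    case PInf
    then show ?thesis using that[of 0] by simp
  next
    case MInf
    then show ?thesis using F_gt_MInf by force
  qed
  \<comment> \<open>Below \<open>s\<^sub>1\<close> the number \<open>k - s\<^sub>1 + s\<close> is at
    most \<open>k\<close>, and \<open>F 0\<close> is a lower bound for \<open>F\<close> on the half
    line.\<close>
  have "ereal (min K (k - s\<^sub>1) + s) \<le> F (H s / c\<^sub>0)" for s
  proof (cases "s\<^sub>1 \<le> s")
    case True
    have "ereal (min K (k - s\<^sub>1) + s) \<le> ereal (K + s)" by simp
    also have "\<dots> \<le> F (H s / c\<^sub>0)" by (rule K[OF True])
    finally show ?thesis .
  next
    case False
    then have "ereal (min K (k - s\<^sub>1) + s) \<le> ereal k" by simp
    also note k
    also have "F 0 \<le> F (H s / c\<^sub>0)" using nonneg by (intro F_mono) auto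
    finally show ?thesis .
  qed
  then show ?thesis by blast
qed

text \<open>The two bounds on \<open>X\<close> give the two sides. From \<open>X \<le> B\<close> the
  loss of \<open>s - X\<close> dominates that of the constant \<open>s - B\<close>; from
  \<open>- B \<le> X\<close> the shift \<open>s - B\<close> keeps the argument at or below a level
  of finite loss.\<close>

lemma tnrm_finite:
  assumes X: "X \<in> bounded_rvs M"
  obtains \<tau> where "tnrm M F G H X = ereal \<tau>"
proof -
  obtain B where B: "0 < B" "AE \<omega> in M. \<bar>X \<omega>\<bar> \<le> B" using X by (rule bounded_rvs_boundE)
  obtain K where K: "\<And>s. ereal (K + s) \<le> F (H s / c\<^sub>0)" using loss_const_bounded_below by auto
  have "ereal (K - B) \<le> loss (\<lambda>\<omega>. s - X \<omega>) - ereal s" for s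
  proof -
    have "AE \<omega> in M. H (s - B) \<le> \<bar>H (s - X \<omega>)\<bar>"
      using B(2)
    proof eventually_elim
      case (elim \<omega>)
      then have "H (s - B) \<le> H (s - X \<omega>)" by (intro monoD[OF H_increasing]) auto
      then show ?case by simp
    qed
    then have "H (s - B) / c\<^sub>0 \<le> nrm (\<lambda>\<omega>. H (s - X \<omega>))"
      using H_nonneg by (intro const_le_nrm H_bounded_rvs bounded_rvs_const_minus X) auto
    then have "F (H (s - B) / c\<^sub>0) \<le> loss (\<lambda>\<omega>. s - X \<omega>)"
      unfolding loss_def using H_nonneg inverse_at_one_pos by (intro F_mono) auto
    with K[of "s - B"] have "ereal (K + (s - B)) \<le> loss (\<lambda>\<omega>. s - X \<omega>)" by (rule order_trans)
    then show ?thesis by (cases "loss (\<lambda>\<omega>. s - X \<omega>)") auto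
  qed
  then have lower: "ereal (K - B) \<le> tnrm M F G H X" unfolding tnrm_eq by (intro INF_greatest)
  obtain s K' where s: "\<And>U. AE \<omega> in M. U \<omega> \<le> s \<Longrightarrow> loss U \<le> ereal K'" using loss_finite by blast
  have "tnrm M F G H X \<le> loss (\<lambda>\<omega>. (s - B) - X \<omega>) - ereal (s - B)"
    unfolding tnrm_eq by (rule INF_lower) simp
  also have "\<dots> \<le> ereal K' - ereal (s - B)"
  proof (intro ereal_minus_mono s order_refl)
    show "AE \<omega> in M. s - B - X \<omega> \<le> s" using B(2) by eventually_elim auto
  qed
  finally show thesis using lower that by (cases "tnrm M F G H X") auto
qed

end

section \<open>The penalty function\<close>

context prob_space
begin

lemma step_rv_lincomb:
  "step_rv \<pi> (\<lambda>A. a * u A + b * v A) \<omega> = a * step_rv \<pi> u \<omega> + b * step_rv \<pi> v \<omega>"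
  by (simp add: step_rv_def sum.distrib sum_distrib_left algebra_simps)

lemma step_rv_minus: "step_rv \<pi> (\<lambda>A. - u A) \<omega> = - step_rv \<pi> u \<omega>"
  by (simp add: step_rv_def sum_negf)

end

context tnrm_setting
begin

abbreviation T :: "('a \<Rightarrow> real) \<Rightarrow> ereal" where "T \<equiv> tnrm M F G H"

text \<open>Young's inequality is applied to \<open>H\<close> pointwise at
  \<open>Z \<omega> / \<eta> \<omega>\<close>, multiplied by \<open>\<eta> \<omega>\<close>, and to
  \<open>F\<close> at the norm \<open>n\<close> of the transformed variable. What remains is the
  expectation of \<open>\<eta> \<omega> * H (U \<omega>)\<close> against \<open>n * o'\<close>,
  which Hoelder's inequality settles.\<close>

lemma weak_duality:
  assumes Z: "Z \<in> bounded_rvs M" "\<And>\<omega>. 0 \<le> Z \<omega>" "(\<integral>\<omega>. Z \<omega> \<partial>M) = 1"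
    and \<eta>: "\<eta> \<in> dual_multipliers M G Z"
  shows "simple_conjugate M T (\<lambda>\<omega>. - Z \<omega>) \<le> dual_penalty M F G H Z \<eta>"
  unfolding simple_conjugate_def
proof (rule SUP_least)
  fix X assume "X \<in> simple_rvs M"
  then have X: "X \<in> bounded_rvs M" using simple_rvs_subset_bounded_rvs by auto
  have \<eta>_dual: "\<eta> \<in> dual_space" and \<eta>_nonneg: "AE \<omega> in M. 0 \<le> \<eta> \<omega>"
    and \<eta>_support: "AE \<omega> in M. \<eta> \<omega> = 0 \<longrightarrow> Z \<omega> = 0"
    using \<eta> by (auto simp: dual_multipliers_def)
  define c where "c = (\<integral>\<omega>. X \<omega> * - Z \<omega> \<partial>M)"
  have "ereal c - (loss (\<lambda>\<omega>. s - X \<omega>) - ereal s) \<le> dual_penalty M F G H Z \<eta>" for s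
  proof -
    define U where "U \<omega> = s - X \<omega>" for \<omega>
    have U: "U \<in> bounded_rvs M" unfolding U_def[abs_def] using X by (rule bounded_rvs_const_minus)
    note HU = H_bounded_rvs[OF U]
    have UZ: "integrable M (\<lambda>\<omega>. U \<omega> * Z \<omega>)" by (intro bounded_rvs_integrable bounded_rvs_mult U Z)
    have \<eta>HU: "integrable M (\<lambda>\<omega>. \<eta> \<omega> * H (U \<omega>))"
      by (intro integrable_mult_bounded orlicz_spaceD_integrable[OF \<eta>_dual] HU)
    have "integrable M Z" "integrable M (\<lambda>\<omega>. X \<omega> * Z \<omega>)"
      by (intro bounded_rvs_integrable bounded_rvs_mult X Z)+
    then have UZ_eq: "(\<integral>\<omega>. U \<omega> * Z \<omega> \<partial>M) = s + c"
      by (simp add: U_def c_def left_diff_distrib Z(3))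
    show ?thesis
    proof (cases "loss U")
      case (real l)
      define n where "n = nrm (\<lambda>\<omega>. H (U \<omega>))"
      define o' where "o' = real_of_ereal (orlicz_norm M G \<eta>)"
      have "ereal ((\<integral>\<omega>. U \<omega> * Z \<omega> \<partial>M) - (\<integral>\<omega>. \<eta> \<omega> * H (U \<omega>) \<partial>M))
          = ereal_expectation M (\<lambda>\<omega>. ereal (U \<omega> * Z \<omega> - \<eta> \<omega> * H (U \<omega>)))"
        using UZ \<eta>HU by (subst ereal_expectation_real[where f = "\<lambda>\<omega>. U \<omega> * Z \<omega> - \<eta> \<omega> * H (U \<omega>)"]) auto
      also have "\<dots> \<le> ereal_expectation M (\<lambda>\<omega>. ereal (\<eta> \<omega>) *
          convex_conjugate_on UNIV (\<lambda>x. ereal (H x)) (1 / \<eta> \<omega> * Z \<omega> * indicator {\<omega>. 0 < Z \<omega>} \<omega>))"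
        (is "_ \<le> ?E")
      proof (rule ereal_expectation_mono)
        show "AE \<omega> in M. ereal (U \<omega> * Z \<omega> - \<eta> \<omega> * H (U \<omega>)) \<le> ereal (\<eta> \<omega>) *
          convex_conjugate_on UNIV (\<lambda>x. ereal (H x)) (1 / \<eta> \<omega> * Z \<omega> * indicator {\<omega>. 0 < Z \<omega>} \<omega>)"
          using \<eta>_nonneg \<eta>_support
        proof eventually_elim
          case (elim \<omega>)
          show ?case
          proof (cases "\<eta> \<omega> = 0")
            \<comment> \<open>Where \<open>\<eta>\<close> vanishes so does \<open>Z\<close>, and 0
              times the conjugate is 0 even if the conjugate is infinite.\<close>
            case True
            then show ?thesis using elim by (simp flip: zero_ereal_def)
          next
            case False
            then have pos: "0 < \<eta> \<omega>" using elim by simp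
            have arg: "1 / \<eta> \<omega> * Z \<omega> * indicator {\<omega>. 0 < Z \<omega>} \<omega> = Z \<omega> / \<eta> \<omega>"
              using Z(2)[of \<omega>] by (auto simp: indicator_def)
            have "ereal (U \<omega> * (Z \<omega> / \<eta> \<omega>)) - ereal (H (U \<omega>))
                \<le> convex_conjugate_on UNIV (\<lambda>x. ereal (H x)) (Z \<omega> / \<eta> \<omega>)"
              unfolding convex_conjugate_on_def by (rule SUP_upper) simp
            then have "ereal (\<eta> \<omega>) * (ereal (U \<omega> * (Z \<omega> / \<eta> \<omega>)) - ereal (H (U \<omega>)))
                \<le> ereal (\<eta> \<omega>) * convex_conjugate_on UNIV (\<lambda>x. ereal (H x)) (Z \<omega> / \<eta> \<omega>)"
              using pos by (intro ereal_mult_left_mono) auto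
            moreover have "ereal (\<eta> \<omega>) * (ereal (U \<omega> * (Z \<omega> / \<eta> \<omega>)) - ereal (H (U \<omega>)))
                = ereal (U \<omega> * Z \<omega> - \<eta> \<omega> * H (U \<omega>))"
              using pos by (simp add: field_simps)
            ultimately show ?thesis unfolding arg by simp
          qed
        qed
      qed
      finally have E: "ereal ((\<integral>\<omega>. U \<omega> * Z \<omega> \<partial>M) - (\<integral>\<omega>. \<eta> \<omega> * H (U \<omega>) \<partial>M)) \<le> ?E" .
      have "ereal (n * o') - F n \<le> convex_conjugate_on {0..} F o'"
        unfolding convex_conjugate_on_def n_def using nrm_nonneg by (intro SUP_upper) auto
      then have "ereal (n * o' - l) \<le> convex_conjugate_on {0..} F o'"
        using real by (simp add: n_def loss_def)
      with E have "ereal ((\<integral>\<omega>. U \<omega> * Z \<omega> \<partial>M) - (\<integral>\<omega>. \<eta> \<omega> * H (U \<omega>) \<partial>M)) + ereal (n * o' - l)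
          \<le> dual_penalty M F G H Z \<eta>"
        unfolding dual_penalty_def o'_def by (rule add_mono)
      moreover have "(\<integral>\<omega>. \<eta> \<omega> * H (U \<omega>) \<partial>M) \<le> n * o'"
        unfolding n_def o'_def by (rule hoelder[OF \<eta>_dual HU])
      then have "ereal c - (loss U - ereal s)
          \<le> ereal ((\<integral>\<omega>. U \<omega> * Z \<omega> \<partial>M) - (\<integral>\<omega>. \<eta> \<omega> * H (U \<omega>) \<partial>M)) + ereal (n * o' - l)"
        by (simp add: real UZ_eq)
      ultimately show ?thesis unfolding U_def[symmetric] by (rule order_trans[rotated])
    next
      case PInf
      then show ?thesis by (simp add: U_def[abs_def])
    next
      case MInf
      then show ?thesis using F_nrm_gt[of "\<lambda>\<omega>. H (U \<omega>)"] by (simp add: loss_def)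
    qed
  qed
  then have "(SUP s. ereal c - (loss (\<lambda>\<omega>. s - X \<omega>) - ereal s)) \<le> dual_penalty M F G H Z \<eta>"
    by (intro SUP_least)
  then show "ereal (\<integral>\<omega>. X \<omega> * - Z \<omega> \<partial>M) - T X \<le> dual_penalty M F G H Z \<eta>"
    unfolding tnrm_eq c_def by (subst (asm) SUP_ereal_minus_right) auto
qed

lemma nrm_zero: "nrm (\<lambda>_. 0) = 0"
proof -
  have "nrm (\<lambda>_. 0) \<le> 0 + e" if "0 < e" for e
    using nrm_bound[of "e * c\<^sub>0" "\<lambda>_. 0"] that inverse_at_one_pos by simp
  then have "nrm (\<lambda>_. 0) \<le> 0" by (rule field_le_epsilon)
  then show ?thesis using nrm_nonneg[of "\<lambda>_. 0"] by simp
qed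

text \<open>The multiplier comes from the perturbed problem of minimising \<open>F(\<parallel>y\<parallel>) - E[u Z]\<close> subject to
  \<open>H(u) \<le> y + w\<close>; condition FGH1 is its Slater condition.\<close>

lemma strong_duality:
  assumes \<pi>: "\<pi> \<in> finite_partitions M"
    and Z: "Z \<in> borel_measurable M" "AE \<omega> in M. Z \<omega> = step_rv \<pi> z \<omega>"
    and z_nonneg: "\<And>A. 0 \<le> z A"
    and \<alpha>: "simple_conjugate M T (\<lambda>\<omega>. - Z \<omega>) = ereal \<alpha>"
  shows "\<exists>\<eta>\<in>dual_multipliers M G Z. dual_penalty M F G H Z \<eta> \<le> ereal \<alpha>"
proof -
  define p where "p A = prob A" for A
  have p: "0 < p A" if "A \<in> \<pi>" for A using finite_partitionsD(5)[OF \<pi> that] by (simp add: p_def)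
  have p_sum: "(\<Sum>A\<in>\<pi>. p A) = 1" unfolding p_def by (rule partition_prob_sum[OF \<pi>])
  have fin: "finite \<pi>" by (rule finite_partitionsD(1)[OF \<pi>])
  note step_b = step_rv_bounded[OF \<pi>]
  \<comment> \<open>The shift 0 suffices, since \<open>u\<close> already ranges over all
    coordinates.\<close>
  have bound: "(\<Sum>A\<in>\<pi>. p A * z A * u A) \<le> \<alpha> + l" if "loss (step_rv \<pi> u) \<le> ereal l" for u l
  proof -
    let ?X = "step_rv \<pi> (\<lambda>A. - u A)"
    have "T ?X \<le> loss (\<lambda>\<omega>. 0 - ?X \<omega>) - ereal 0" unfolding tnrm_eq by (rule INF_lower) simp
    also have "\<dots> \<le> ereal l" using that by (simp add: step_rv_minus flip: zero_ereal_def)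
    finally have "T ?X \<le> ereal l" .
    have "(\<integral>\<omega>. ?X \<omega> * - Z \<omega> \<partial>M) = (\<integral>\<omega>. step_rv \<pi> z \<omega> * step_rv \<pi> u \<omega> \<partial>M)"
      using Z by (intro integral_cong_AE) (auto intro!: step_rv_measurable \<pi> borel_measurable_times simp: step_rv_minus)
    also have "\<dots> = (\<Sum>A\<in>\<pi>. p A * z A * u A)"
      unfolding p_def by (rule integral_step_rv_mult[OF \<pi>])
    finally have "ereal (\<Sum>A\<in>\<pi>. p A * z A * u A) - ereal l \<le> ereal (\<integral>\<omega>. ?X \<omega> * - Z \<omega> \<partial>M) - T ?X"
      using \<open>T ?X \<le> ereal l\<close> by (intro ereal_minus_mono) auto
    also have "\<dots> \<le> ereal \<alpha>"
      unfolding \<alpha>[symmetric] simple_conjugate_def by (intro SUP_upper step_rv_simple[OF \<pi>])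
    finally show ?thesis by simp
  qed
  \<comment> \<open>The cost is \<open>F\<close> of the norm of \<open>y\<close>, minus the pairing
    of \<open>u\<close> with the density, plus \<alpha>. The term \<alpha> normalises the value at
    \<open>w = 0\<close> to be nonnegative, by \<open>bound\<close>. The separate variable
    \<open>y\<close> takes \<open>H(u)\<close> out of the norm, so that each block has its own
    constraint and multiplier.\<close>
  define E where "E w r \<longleftrightarrow> (\<exists>u y. (\<forall>A\<in>\<pi>. 0 \<le> y A \<and> H (u A) \<le> y A + w A) \<and>
      F (nrm (step_rv \<pi> y)) \<le> ereal (r - \<alpha> + (\<Sum>A\<in>\<pi>. p A * z A * u A)))" for w r
  obtain s\<^sub>0 \<epsilon> K where slater: "0 < \<epsilon>" "F ((H s\<^sub>0 + \<epsilon>) / c\<^sub>0) = ereal K" by (rule slater_point)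
  define y\<^sub>0 where "y\<^sub>0 = H s\<^sub>0 + \<epsilon>"
  have y\<^sub>0: "0 < y\<^sub>0" using slater(1) H_nonneg by (simp add: y\<^sub>0_def add_nonneg_pos)
  have F_y\<^sub>0: "F (nrm (step_rv \<pi> (\<lambda>_. y\<^sub>0))) \<le> ereal K"
  proof -
    have "AE \<omega> in M. \<bar>step_rv \<pi> (\<lambda>_. y\<^sub>0) \<omega>\<bar> \<le> y\<^sub>0"
      using y\<^sub>0 by (intro AE_I2) (auto elim!: block_exists[OF \<pi>] simp: step_rv_eq[OF \<pi>])
    then have "nrm (step_rv \<pi> (\<lambda>_. y\<^sub>0)) \<le> y\<^sub>0 / c\<^sub>0" using y\<^sub>0 by (intro nrm_bound)
    then show ?thesis using F_mono[OF nrm_nonneg] slater(2) by (fastforce simp: y\<^sub>0_def)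
  qed
  define r\<^sub>0 where "r\<^sub>0 = K + \<alpha> - (\<Sum>A\<in>\<pi>. p A * z A * s\<^sub>0)"
  \<comment> \<open>The constants \<open>s\<^sub>0\<close> and \<open>y\<^sub>0\<close> are feasible
    for every perturbation that is at least \<open>- \<epsilon>\<close>, at one and the same cost.
    This gives both axis directions and, as arbitrarily large perturbations are allowed, the sign of
    \<open>\<eta>\<close>.\<close>
  have E_slater: "E w r\<^sub>0" if "\<And>A. A \<in> \<pi> \<Longrightarrow> - \<epsilon> \<le> w A" for w
  proof -
    have "\<forall>A\<in>\<pi>. 0 \<le> y\<^sub>0 \<and> H s\<^sub>0 \<le> y\<^sub>0 + w A" using y\<^sub>0 that by (force simp: y\<^sub>0_def)
    moreover have "F (nrm (step_rv \<pi> (\<lambda>_. y\<^sub>0))) \<le> ereal (r\<^sub>0 - \<alpha> + (\<Sum>A\<in>\<pi>. p A * z A * s\<^sub>0))"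
      using F_y\<^sub>0 by (simp add: r\<^sub>0_def)
    ultimately show ?thesis
      unfolding E_def by (rule_tac x = "\<lambda>_. s\<^sub>0" in exI, rule_tac x = "\<lambda>_. y\<^sub>0" in exI) simp
  qed
  have "\<exists>\<xi>. \<forall>w r. E w r \<longrightarrow> (\<Sum>A\<in>\<pi>. \<xi> A * w A) \<le> r"
  proof (rule convex_relation_supported[OF fin])
    fix w w' r r' t
    assume "E w r" "E w' r'" and t: "0 \<le> t" "t \<le> (1::real)"
    then obtain u y u' y'
      where 1: "\<forall>A\<in>\<pi>. 0 \<le> y A \<and> H (u A) \<le> y A + w A"
          "F (nrm (step_rv \<pi> y)) \<le> ereal (r - \<alpha> + (\<Sum>A\<in>\<pi>. p A * z A * u A))"
        and 2: "\<forall>A\<in>\<pi>. 0 \<le> y' A \<and> H (u' A) \<le> y' A + w' A"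
          "F (nrm (step_rv \<pi> y')) \<le> ereal (r' - \<alpha> + (\<Sum>A\<in>\<pi>. p A * z A * u' A))"
      unfolding E_def by blast
    define u'' where "u'' A = (1 - t) * u A + t * u' A" for A
    define y'' where "y'' A = (1 - t) * y A + t * y' A" for A
    have constraint: "0 \<le> y'' A \<and> H (u'' A) \<le> y'' A + ((1 - t) * w A + t * w' A)" if "A \<in> \<pi>" for A
    proof
      show "0 \<le> y'' A" using 1 2 t that by (simp add: y''_def)
      have "H (u'' A) \<le> (1 - t) * H (u A) + t * H (u' A)" unfolding u''_def by (rule H_convexD[OF t])
      also have "\<dots> \<le> (1 - t) * (y A + w A) + t * (y' A + w' A)"
        using 1 2 t that by (intro add_mono mult_left_mono) auto
      finally show "H (u'' A) \<le> y'' A + ((1 - t) * w A + t * w' A)" by (simp add: y''_def algebra_simps)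
    qed
    have "nrm (step_rv \<pi> y'') \<le> (1 - t) * nrm (step_rv \<pi> y) + t * nrm (step_rv \<pi> y')"
      unfolding y''_def step_rv_lincomb[abs_def] by (rule nrm_convex[OF step_b step_b t])
    then have "F (nrm (step_rv \<pi> y'')) \<le> F ((1 - t) * nrm (step_rv \<pi> y) + t * nrm (step_rv \<pi> y'))"
      by (intro F_mono nrm_nonneg)
    also have "\<dots> \<le> ereal ((1 - t) * (r - \<alpha> + (\<Sum>A\<in>\<pi>. p A * z A * u A))
        + t * (r' - \<alpha> + (\<Sum>A\<in>\<pi>. p A * z A * u' A)))"
      by (intro F_convex_le nrm_nonneg t 1 2)
    also have "(1 - t) * (r - \<alpha> + (\<Sum>A\<in>\<pi>. p A * z A * u A)) + t * (r' - \<alpha> + (\<Sum>A\<in>\<pi>. p A * z A * u' A))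
        = ((1 - t) * r + t * r') - \<alpha> + (\<Sum>A\<in>\<pi>. p A * z A * u'' A)"
      by (simp add: u''_def sum.distrib sum_subtractf sum_distrib_left algebra_simps)
    finally show "E (\<lambda>A. (1 - t) * w A + t * w' A) ((1 - t) * r + t * r')"
      unfolding E_def using constraint by blast
  next
    fix w r assume "E w r" and w: "\<forall>A\<in>\<pi>. w A = 0"
    then obtain u y where uy: "\<forall>A\<in>\<pi>. 0 \<le> y A \<and> H (u A) \<le> y A"
        "F (nrm (step_rv \<pi> y)) \<le> ereal (r - \<alpha> + (\<Sum>A\<in>\<pi>. p A * z A * u A))"
      unfolding E_def by fastforce
    have "AE \<omega> in M. \<bar>H (step_rv \<pi> u \<omega>)\<bar> \<le> \<bar>step_rv \<pi> y \<omega>\<bar>"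
      using uy(1) H_nonneg by (intro AE_I2) (force elim!: block_exists[OF \<pi>] simp: step_rv_eq[OF \<pi>])
    then have "loss (step_rv \<pi> u) \<le> F (nrm (step_rv \<pi> y))"
      unfolding loss_def by (intro F_mono nrm_mono nrm_nonneg H_bounded_rvs step_b)
    from bound[OF order_trans[OF this uy(2)]] show "0 \<le> r" by simp
  next
    fix A assume "A \<in> \<pi>"
    then show "\<exists>w r. E w r \<and> 0 < w A \<and> (\<forall>B\<in>\<pi> - {A}. w B = 0)"
      using slater(1) by (intro exI[of _ "\<lambda>B. if B = A then \<epsilon> else 0"] exI[of _ r\<^sub>0]) (auto intro!: E_slater)
    show "\<exists>w r. E w r \<and> w A < 0 \<and> (\<forall>B\<in>\<pi> - {A}. w B = 0)"
      using slater(1) by (intro exI[of _ "\<lambda>B. if B = A then - \<epsilon> else 0"] exI[of _ r\<^sub>0]) (auto intro!: E_slater)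
  qed
  then obtain \<xi> where \<xi>: "\<And>w r. E w r \<Longrightarrow> (\<Sum>A\<in>\<pi>. \<xi> A * w A) \<le> r" by blast
  \<comment> \<open>Division by the block probabilities turns the functional into a density; the
    sign is reversed because relaxing the constraint can only lower the cost.\<close>
  define \<eta> where "\<eta> A = - \<xi> A / p A" for A
  have \<xi>_eq: "\<xi> A = - (p A * \<eta> A)" if "A \<in> \<pi>" for A using p[OF that] by (simp add: \<eta>_def)
  have \<eta>_nonneg: "0 \<le> \<eta> A" if A: "A \<in> \<pi>" for A
  proof (rule ccontr)
    assume "\<not> 0 \<le> \<eta> A"
    then have pos: "0 < \<xi> A" using p[OF A] by (simp add: \<xi>_eq[OF A] mult_pos_neg)
    define n where "n = (\<bar>r\<^sub>0\<bar> + 1) / \<xi> A"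
    have "0 \<le> n" using pos by (simp add: n_def)
    then have "(\<Sum>B\<in>\<pi>. \<xi> B * (if B = A then n else 0)) \<le> r\<^sub>0"
      using slater(1) by (intro \<xi> E_slater) auto
    moreover have "(\<Sum>B\<in>\<pi>. \<xi> B * (if B = A then n else 0)) = \<xi> A * n"
      using fin A by (simp add: if_distrib cong: if_cong)
    ultimately show False using pos by (simp add: n_def)
  qed
  \<comment> \<open>The Lagrangian integrand on a block. For \<open>\<eta> A > 0\<close> its
    supremum over \<open>v\<close>, named \<open>k A\<close> below, is \<open>\<eta> A\<close> times
    the conjugate of \<open>H\<close> at \<open>z A / \<eta> A\<close>.\<close>
  define q where "q A v = z A * v - \<eta> A * H v" for A v
  \<comment> \<open>The perturbation \<open>H (u A) - y A\<close> makes every pair feasible, so the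
    supporting inequality holds with \<open>u\<close> free and only \<open>y \<ge> 0\<close>
    required.\<close>
  have lagrange: "(\<Sum>A\<in>\<pi>. p A * q A (u A)) + (\<Sum>A\<in>\<pi>. p A * (\<eta> A * y A)) \<le> \<alpha> + l"
    if "\<And>A. A \<in> \<pi> \<Longrightarrow> 0 \<le> y A" "F (nrm (step_rv \<pi> y)) \<le> ereal l" for u y l
  proof -
    have "E (\<lambda>A. H (u A) - y A) (l + \<alpha> - (\<Sum>A\<in>\<pi>. p A * z A * u A))"
      unfolding E_def using that by (rule_tac x = u in exI, rule_tac x = y in exI) auto
    from \<xi>[OF this] have "(\<Sum>A\<in>\<pi>. \<xi> A * (H (u A) - y A)) \<le> l + \<alpha> - (\<Sum>A\<in>\<pi>. p A * z A * u A)" .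
    moreover have "(\<Sum>A\<in>\<pi>. \<xi> A * (H (u A) - y A)) = (\<Sum>A\<in>\<pi>. p A * q A (u A)) + (\<Sum>A\<in>\<pi>. p A * (\<eta> A * y A))
        - (\<Sum>A\<in>\<pi>. p A * z A * u A)"
      unfolding sum.distrib[symmetric] sum_subtractf[symmetric]
      by (intro sum.cong) (simp_all add: \<xi>_eq q_def algebra_simps)
    ultimately show ?thesis by simp
  qed
  \<comment> \<open>Only the value on \<open>A\<close> moves; the other blocks stay at the Slater
    point, which isolates \<open>q A v\<close> in the Lagrangian bound.\<close>
  have q_bdd: "\<exists>C. \<forall>v. q A v \<le> C" if A: "A \<in> \<pi>" for A
  proof -
    define R where "R = (\<Sum>B\<in>\<pi> - {A}. p B * q B s\<^sub>0) + (\<Sum>B\<in>\<pi>. p B * (\<eta> B * y\<^sub>0))"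
    have "q A v \<le> (\<alpha> + K - R) / p A" for v
    proof -
      have "(\<Sum>B\<in>\<pi>. p B * q B (((\<lambda>_. s\<^sub>0)(A := v)) B)) + (\<Sum>B\<in>\<pi>. p B * (\<eta> B * y\<^sub>0)) \<le> \<alpha> + K"
        using y\<^sub>0 F_y\<^sub>0 by (intro lagrange) auto
      moreover have "(\<Sum>B\<in>\<pi>. p B * q B (((\<lambda>_. s\<^sub>0)(A := v)) B)) = p A * q A v + (\<Sum>B\<in>\<pi> - {A}. p B * q B s\<^sub>0)"
        by (simp add: sum.remove[OF fin A])
      ultimately show ?thesis using p[OF A] by (simp add: R_def field_simps)
    qed
    then show ?thesis by blast
  qed
  \<comment> \<open>With \<open>\<eta> A = 0\<close> the function \<open>q A\<close> is linear of
    slope \<open>z A\<close>, and it is bounded above. This yields the support condition on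
    multipliers.\<close>
  have \<eta>_zero: "z A = 0" if A: "A \<in> \<pi>" and "\<eta> A = 0" for A
  proof (rule ccontr)
    assume "z A \<noteq> 0"
    obtain C where C: "\<And>v. q A v \<le> C" using q_bdd[OF A] by auto
    have "q A ((C + 1) / z A) = C + 1" using \<open>z A \<noteq> 0\<close> \<open>\<eta> A = 0\<close> by (simp add: q_def)
    then show False using C[of "(C + 1) / z A"] by simp
  qed
  define k where "k A = (SUP v. q A v)" for A
  have q_le_k: "q A v \<le> k A" if "A \<in> \<pi>" for A v
    unfolding k_def using q_bdd[OF that] by (intro cSUP_upper) (auto intro: bdd_aboveI2)
  \<comment> \<open>The blocks are independent in \<open>u\<close>, so each is optimised separately
    up to \<open>e\<close>; the errors average to \<open>e\<close> because the probabilities sum to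
    1.\<close>
  have lagrange_k: "(\<Sum>A\<in>\<pi>. p A * k A) + (\<Sum>A\<in>\<pi>. p A * (\<eta> A * y A)) \<le> \<alpha> + l"
    if y: "\<And>A. A \<in> \<pi> \<Longrightarrow> 0 \<le> y A" "F (nrm (step_rv \<pi> y)) \<le> ereal l" for y l
  proof (rule field_le_epsilon)
    fix e :: real assume e: "0 < e"
    have "\<exists>v. k A - e < q A v" if "A \<in> \<pi>" for A
    proof -
      have "k A - e < (SUP v. q A v)" using e by (simp add: k_def)
      then show ?thesis using q_bdd[OF that] by (subst (asm) less_cSUP_iff) (auto intro: bdd_aboveI2)
    qed
    then obtain u where u: "\<And>A. A \<in> \<pi> \<Longrightarrow> k A - e < q A (u A)" by metis
    have "(\<Sum>A\<in>\<pi>. p A * k A) - e = (\<Sum>A\<in>\<pi>. p A * (k A - e))"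
      by (simp add: right_diff_distrib sum_subtractf p_sum flip: sum_distrib_right)
    also have "\<dots> \<le> (\<Sum>A\<in>\<pi>. p A * q A (u A))"
      using p u by (intro sum_mono mult_left_mono) (auto intro: less_imp_le)
    finally show "(\<Sum>A\<in>\<pi>. p A * k A) + (\<Sum>A\<in>\<pi>. p A * (\<eta> A * y A)) \<le> \<alpha> + l + e"
      using lagrange[OF y, of u] by simp
  qed
  define \<kappa> where "\<kappa> = (\<Sum>A\<in>\<pi>. p A * k A)"
  define \<eta>' where "\<eta>' = step_rv \<pi> \<eta>"
  have \<eta>'_dual: "\<eta>' \<in> dual_space" unfolding \<eta>'_def using step_b bounded_rvs_subset_dual_space by blast
  have H_part: "ereal_expectation M (\<lambda>\<omega>. ereal (\<eta>' \<omega>) *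
      convex_conjugate_on UNIV (\<lambda>x. ereal (H x)) (1 / \<eta>' \<omega> * Z \<omega> * indicator {\<omega>. 0 < Z \<omega>} \<omega>)) \<le> ereal \<kappa>"
  proof -
    have "AE \<omega> in M. ereal (\<eta>' \<omega>) * convex_conjugate_on UNIV (\<lambda>x. ereal (H x))
        (1 / \<eta>' \<omega> * Z \<omega> * indicator {\<omega>. 0 < Z \<omega>} \<omega>) \<le> ereal (step_rv \<pi> k \<omega>)"
      using Z(2) AE_space
    proof eventually_elim
      case (elim \<omega>)
      then obtain A where A: "A \<in> \<pi>" "\<omega> \<in> A" using block_exists[OF \<pi>] by blast
      have eqs: "\<eta>' \<omega> = \<eta> A" "Z \<omega> = z A" "step_rv \<pi> k \<omega> = k A"
        using elim by (simp_all add: \<eta>'_def step_rv_eq[OF \<pi> A])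
      show ?case
      proof (cases "\<eta> A = 0")
        \<comment> \<open>The product is 0 here whatever the conjugate is, and \<open>k A\<close> is
          nonnegative because \<open>q A 0 = 0\<close>.\<close>
        case True
        then have "q A 0 = 0" by (simp add: q_def)
        then show ?thesis using True q_le_k[OF A(1), of 0] by (simp add: eqs flip: zero_ereal_def)
      next
        case False
        then have pos: "0 < \<eta> A" using \<eta>_nonneg[OF A(1)] by simp
        have arg: "1 / \<eta>' \<omega> * Z \<omega> * indicator {\<omega>. 0 < Z \<omega>} \<omega> = z A / \<eta> A"
          using z_nonneg[of A] by (auto simp: eqs indicator_def)
        have "convex_conjugate_on UNIV (\<lambda>x. ereal (H x)) (z A / \<eta> A) \<le> ereal (k A / \<eta> A)"
          unfolding convex_conjugate_on_def
        proof (rule SUP_least)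
          fix v
          have "v * (z A / \<eta> A) - H v = q A v / \<eta> A" using pos by (simp add: q_def field_simps)
          also have "\<dots> \<le> k A / \<eta> A" using q_le_k[OF A(1)] pos by (intro divide_right_mono) auto
          finally show "ereal (v * (z A / \<eta> A)) - ereal (H v) \<le> ereal (k A / \<eta> A)" by simp
        qed
        then have "ereal (\<eta> A) * convex_conjugate_on UNIV (\<lambda>x. ereal (H x)) (z A / \<eta> A)
            \<le> ereal (\<eta> A) * ereal (k A / \<eta> A)" using pos by (intro ereal_mult_left_mono) auto
        also have "\<dots> = ereal (k A)" using pos by simp
        finally show ?thesis unfolding arg by (simp add: eqs)
      qed
    qed
    then have "ereal_expectation M (\<lambda>\<omega>. ereal (\<eta>' \<omega>) * convex_conjugate_on UNIV (\<lambda>x. ereal (H x))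
        (1 / \<eta>' \<omega> * Z \<omega> * indicator {\<omega>. 0 < Z \<omega>} \<omega>)) \<le> ereal_expectation M (\<lambda>\<omega>. ereal (step_rv \<pi> k \<omega>))"
      by (rule ereal_expectation_mono)
    also have "\<dots> = ereal (\<integral>\<omega>. step_rv \<pi> k \<omega> \<partial>M)"
      by (intro ereal_expectation_real bounded_rvs_integrable step_b) simp
    also have "(\<integral>\<omega>. step_rv \<pi> k \<omega> \<partial>M) = \<kappa>" unfolding integral_step_rv[OF \<pi>] by (simp add: \<kappa>_def p_def)
    finally show ?thesis .
  qed
  define o' where "o' = real_of_ereal (orlicz_norm M G \<eta>')"
  have o: "orlicz_norm M G \<eta>' = ereal o'" unfolding o'_def by (rule orlicz_norm_finite[OF \<eta>'_dual])
  \<comment> \<open>For \<open>x > 0\<close> the claim bounds the Orlicz norm by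
    \<open>(\<alpha> + l - \<kappa>) / x\<close>. A competitor \<open>Y\<close> from the unit ball
    is conditioned on \<pi>, scaled by \<open>x\<close>, and inserted through its absolute values as
    the slack \<open>y\<close> of \<open>lagrange_k\<close>.\<close>
  have F_part: "convex_conjugate_on {0..} F o' \<le> ereal (\<alpha> - \<kappa>)"
    unfolding convex_conjugate_on_def
  proof (rule SUP_least)
    fix x :: real assume "x \<in> {0..}"
    then have x: "0 \<le> x" by simp
    show "ereal (x * o') - F x \<le> ereal (\<alpha> - \<kappa>)"
    proof (cases "F x")
      case (real l)
      have "x * o' \<le> \<alpha> + l - \<kappa>"
      proof (cases "x = 0")
        case True
        have "step_rv \<pi> (\<lambda>_. 0) = (\<lambda>_. 0)" by (simp add: step_rv_def fun_eq_iff)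
        then have "F (nrm (step_rv \<pi> (\<lambda>_. 0))) \<le> ereal l" using real True by (simp add: nrm_zero)
        from lagrange_k[OF _ this] show ?thesis using True by (simp add: \<kappa>_def)
      next
        case False
        then have x: "0 < x" using x by simp
        have "orlicz_norm M G \<eta>' \<le> ereal ((\<alpha> + l - \<kappa>) / x)"
          unfolding orlicz_norm_def
        proof (rule SUP_least, clarify)
          fix Y assume Y: "integrable M Y" "lux Y \<le> 1"
          let ?W = "partition_cond_exp M \<pi> Y"
          obtain w where w: "\<And>\<omega>. \<omega> \<in> space M \<Longrightarrow> ?W \<omega> = step_rv \<pi> w \<omega>"
            using partition_cond_exp_step[OF \<pi>] by blast
          have "lux (\<lambda>\<omega>. x * ?W \<omega>) \<le> ereal x"
            using lux_cond_exp[OF subalgebra_partition[OF \<pi>] Y(1)] Y(2) x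
            by (intro lux_scale_le) (auto simp: partition_cond_exp_def)
          \<comment> \<open>Slacks must be nonnegative, hence the absolute values: they leave the
            norm unchanged and, as \<open>\<eta>\<close> is nonnegative, can only increase the
            pairing.\<close>
          moreover have "lux (step_rv \<pi> (\<lambda>A. x * \<bar>w A\<bar>)) \<le> lux (\<lambda>\<omega>. x * ?W \<omega>)"
            using x by (intro lux_mono AE_I2)
              (auto elim!: block_exists[OF \<pi>] simp: w step_rv_eq[OF \<pi>] abs_mult)
          ultimately have "lux (step_rv \<pi> (\<lambda>A. x * \<bar>w A\<bar>)) \<le> ereal x" by (rule order_trans[rotated])
          then have "nrm (step_rv \<pi> (\<lambda>A. x * \<bar>w A\<bar>)) \<le> x" by (simp add: lux_nrm[OF step_b])
          then have "F (nrm (step_rv \<pi> (\<lambda>A. x * \<bar>w A\<bar>))) \<le> ereal l"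
            unfolding real[symmetric] by (intro F_mono nrm_nonneg)
          from lagrange_k[OF _ this] have le: "(\<Sum>A\<in>\<pi>. p A * (\<eta> A * (x * \<bar>w A\<bar>))) \<le> \<alpha> + l - \<kappa>"
            using x by (simp add: \<kappa>_def)
          have "ereal_expectation M (\<lambda>\<omega>. ereal (\<eta>' \<omega> * Y \<omega>)) = ereal (\<integral>\<omega>. Y \<omega> * \<eta>' \<omega> \<partial>M)"
            using integrable_mult_bounded[OF Y(1) step_b]
            by (intro ereal_expectation_real) (auto simp: \<eta>'_def mult.commute)
          also have "(\<integral>\<omega>. Y \<omega> * \<eta>' \<omega> \<partial>M) = (\<integral>\<omega>. step_rv \<pi> \<eta> \<omega> * ?W \<omega> \<partial>M)"
            unfolding partition_cond_exp_integral[OF \<pi> Y(1)] by (simp add: \<eta>'_def mult.commute)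
          also have "\<dots> = (\<integral>\<omega>. step_rv \<pi> \<eta> \<omega> * step_rv \<pi> w \<omega> \<partial>M)"
            by (intro Bochner_Integration.integral_cong) (auto simp: w)
          also have "\<dots> = (\<Sum>A\<in>\<pi>. p A * \<eta> A * w A)" unfolding p_def by (rule integral_step_rv_mult[OF \<pi>])
          also have "\<dots> \<le> (\<Sum>A\<in>\<pi>. p A * \<eta> A * \<bar>w A\<bar>)"
            using p \<eta>_nonneg by (intro sum_mono mult_left_mono) (auto intro!: mult_nonneg_nonneg less_imp_le[OF p])
          also have "\<dots> = (\<Sum>A\<in>\<pi>. p A * (\<eta> A * (x * \<bar>w A\<bar>))) / x"
            unfolding sum_divide_distrib using x by (intro sum.cong) auto
          also have "\<dots> \<le> (\<alpha> + l - \<kappa>) / x" using le x by (intro divide_right_mono) auto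
          finally show "ereal_expectation M (\<lambda>\<omega>. ereal (\<eta>' \<omega> * Y \<omega>)) \<le> ereal ((\<alpha> + l - \<kappa>) / x)"
            by simp
        qed
        then show ?thesis using x by (simp add: o field_simps)
      qed
      then show ?thesis using real by simp
    next
      case MInf
      then show ?thesis using F_gt_MInf x by force
    qed simp
  qed
  have "dual_penalty M F G H Z \<eta>' \<le> ereal \<kappa> + ereal (\<alpha> - \<kappa>)"
    unfolding dual_penalty_def by (intro add_mono H_part F_part[unfolded o'_def])
  then have "dual_penalty M F G H Z \<eta>' \<le> ereal \<alpha>" by simp
  moreover have "\<eta>' \<in> dual_multipliers M G Z"
    unfolding dual_multipliers_def
  proof (intro CollectI conjI \<eta>'_dual)
    show "AE \<omega> in M. 0 \<le> \<eta>' \<omega>"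
      using \<eta>_nonneg by (intro AE_I2) (auto elim!: block_exists[OF \<pi>] simp: step_rv_eq[OF \<pi>] \<eta>'_def)
    show "AE \<omega> in M. \<eta>' \<omega> = 0 \<longrightarrow> Z \<omega> = 0"
      using Z(2) AE_space
    proof eventually_elim
      case (elim \<omega>)
      then obtain A where A: "A \<in> \<pi>" "\<omega> \<in> A" using block_exists[OF \<pi>] by blast
      then show ?case using elim \<eta>_zero[OF A(1)] by (simp add: \<eta>'_def step_rv_eq[OF \<pi> A])
    qed
  qed
  ultimately show ?thesis by blast
qed

end

section \<open>Densities and the dual representation\<close>

text \<open>The sign holds at every point, not only almost surely, because \<open>enn2real\<close>
  takes no negative value; the integral identities are the change of measure.\<close>

lemma (in prob_space) simple_density_measuresD:
  assumes Q: "Q \<in> simple_density_measures M"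
  shows "rv_density M Q \<in> simple_rvs M"
    and "0 \<le> rv_density M Q \<omega>"
    and "(\<integral>\<omega>. rv_density M Q \<omega> \<partial>M) = 1"
    and "f \<in> borel_measurable M \<Longrightarrow> (\<integral>\<omega>. f \<omega> \<partial>Q) = (\<integral>\<omega>. rv_density M Q \<omega> * f \<omega> \<partial>M)"
proof -
  have sets: "sets Q = sets M" and ac: "absolutely_continuous M Q" and prob: "prob_space Q"
    using Q by (auto simp: simple_density_measures_def)
  interpret Q: prob_space Q by fact
  show "rv_density M Q \<in> simple_rvs M" using Q by (simp add: simple_density_measures_def)
  show "0 \<le> rv_density M Q \<omega>" by (simp add: rv_density_def)
  show integral: "(\<integral>\<omega>. f \<omega> \<partial>Q) = (\<integral>\<omega>. rv_density M Q \<omega> * f \<omega> \<partial>M)" if "f \<in> borel_measurable M" for f :: "'a \<Rightarrow> real"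
    unfolding rv_density_def
    using Q.sigma_finite_measure_axioms ac sets that by (rule RN_deriv_integral)
  show "(\<integral>\<omega>. rv_density M Q \<omega> \<partial>M) = 1"
    using integral[of "\<lambda>_. 1"] by (simp add: Q.prob_space)
qed

lemma (in prob_space) step_rv_density:
  assumes \<pi>: "\<pi> \<in> finite_partitions M"
    and z: "\<And>A. A \<in> \<pi> \<Longrightarrow> 0 \<le> z A" "(\<Sum>A\<in>\<pi>. prob A * z A) = 1"
  obtains Q where "Q \<in> simple_density_measures M" "AE \<omega> in M. rv_density M Q \<omega> = step_rv \<pi> z \<omega>"
proof -
  define Q where "Q = density M (\<lambda>\<omega>. ennreal (step_rv \<pi> z \<omega>))"
  have meas[measurable]: "step_rv \<pi> z \<in> borel_measurable M" by (rule step_rv_measurable[OF \<pi>])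
  have nonneg: "AE \<omega> in M. 0 \<le> step_rv \<pi> z \<omega>"
    using z(1) by (intro AE_I2) (auto elim!: block_exists[OF \<pi>] simp: step_rv_eq[OF \<pi>])
  have "emeasure Q (space Q) = (\<integral>\<^sup>+ \<omega>. ennreal (step_rv \<pi> z \<omega>) \<partial>M)"
    unfolding Q_def by (simp add: emeasure_density cong: nn_integral_cong)
  also have "\<dots> = ennreal (\<integral>\<omega>. step_rv \<pi> z \<omega> \<partial>M)"
    by (intro nn_integral_eq_integral bounded_rvs_integrable step_rv_bounded \<pi> nonneg)
  also have "\<dots> = 1" by (simp add: integral_step_rv[OF \<pi>] z(2))
  finally have prob: "prob_space Q" by (rule prob_spaceI)
  have "AE \<omega> in M. ennreal (step_rv \<pi> z \<omega>) = RN_deriv M Q \<omega>"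
    by (rule RN_deriv_unique) (simp_all add: Q_def)
  then have AE_eq: "AE \<omega> in M. rv_density M Q \<omega> = step_rv \<pi> z \<omega>"
    using nonneg
  proof eventually_elim
    case (elim \<omega>)
    then show ?case by (simp add: rv_density_def flip: elim(1))
  qed
  obtain S where S: "simple_function M S" "AE \<omega> in M. step_rv \<pi> z \<omega> = S \<omega>"
    using step_rv_simple[OF \<pi>, of z] by (auto simp: simple_rvs_def)
  from AE_eq S(2) have "AE \<omega> in M. rv_density M Q \<omega> = S \<omega>" by eventually_elim simp
  then have "rv_density M Q \<in> simple_rvs M"
    using S(1) by (auto simp: simple_rvs_def rv_density_def[abs_def])
  then have "Q \<in> simple_density_measures M"
    using prob by (auto simp: simple_density_measures_def Q_def absolutely_continuousI_density)
  then show thesis using AE_eq by (rule that)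
qed

section \<open>Attainment of the penalty and subgradients of the risk measure\<close>

context tnrm_setting
begin

text \<open>The variable 0 competes and has finite \<open>T\<close>. Attainment thus only has to
  treat a real and an infinite penalty.\<close>

lemma simple_conjugate_gt: "- \<infinity> < simple_conjugate M T Z"
proof -
  have zero: "(\<lambda>_. 0) \<in> simple_rvs M" by (auto simp: simple_rvs_def)
  then obtain \<tau> where \<tau>: "T (\<lambda>_. 0) = ereal \<tau>"
    using tnrm_finite simple_rvs_subset_bounded_rvs by blast
  have "ereal (\<integral>\<omega>. 0 * Z \<omega> \<partial>M) - T (\<lambda>_. 0) \<le> simple_conjugate M T Z"
    unfolding simple_conjugate_def using zero by (rule SUP_upper)
  then show ?thesis by (auto simp: \<tau> intro: less_le_trans)
qed

lemma penalty_attained: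
  assumes Q: "Q \<in> simple_density_measures M"
  shows "\<exists>\<eta>\<in>dual_multipliers M G (rv_density M Q).
      simple_conjugate M T (\<lambda>\<omega>. - rv_density M Q \<omega>) = dual_penalty M F G H (rv_density M Q) \<eta>"
    and "\<eta> \<in> dual_multipliers M G (rv_density M Q) \<Longrightarrow>
      simple_conjugate M T (\<lambda>\<omega>. - rv_density M Q \<omega>) \<le> dual_penalty M F G H (rv_density M Q) \<eta>"
proof -
  define Z where "Z = rv_density M Q"
  note Z = simple_density_measuresD[OF Q, folded Z_def]
  have Z_b: "Z \<in> bounded_rvs M" using Z(1) simple_rvs_subset_bounded_rvs by auto
  have weak: "simple_conjugate M T (\<lambda>\<omega>. - Z \<omega>) \<le> dual_penalty M F G H Z \<eta>"
    if "\<eta> \<in> dual_multipliers M G Z" for \<eta>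
    using Z_b Z(2,3) that by (rule weak_duality)
  then show "\<eta> \<in> dual_multipliers M G (rv_density M Q) \<Longrightarrow>
      simple_conjugate M T (\<lambda>\<omega>. - rv_density M Q \<omega>) \<le> dual_penalty M F G H (rv_density M Q) \<eta>"
    by (simp add: Z_def)
  have "\<exists>\<eta>\<in>dual_multipliers M G Z. dual_penalty M F G H Z \<eta> \<le> simple_conjugate M T (\<lambda>\<omega>. - Z \<omega>)"
  proof (cases "simple_conjugate M T (\<lambda>\<omega>. - Z \<omega>)")
    case (real \<alpha>)
    obtain \<pi> z where \<pi>: "\<pi> \<in> finite_partitions M" and z: "AE \<omega> in M. Z \<omega> = step_rv \<pi> z \<omega>"
      using Z(1) by (rule simple_rvs_step)
    \<comment> \<open>\<open>strong_duality\<close> asks for nonnegative coordinates at every set,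
      even outside \<pi>; truncation at 0 is harmless because \<open>Z\<close> is
      nonnegative.\<close>
    from z have "AE \<omega> in M. Z \<omega> = step_rv \<pi> (\<lambda>A. max 0 (z A)) \<omega>"
      using AE_space
    proof eventually_elim
      case (elim \<omega>)
      then show ?case using Z(2)[of \<omega>] step_rv_compose[OF \<pi> elim(2), of "max 0" z] by simp
    qed
    then show ?thesis unfolding real
      using Z_b real by (intro strong_duality[OF \<pi>, where z = "\<lambda>A. max 0 (z A)"]) (auto intro: bounded_rvs_measurable)
  next
    \<comment> \<open>By weak duality every multiplier has objective \<infinity>, so any one attains
      the minimum; the constant 1 is bounded and vanishes nowhere.\<close>
    case PInf
    have "(\<lambda>_. 1) \<in> dual_multipliers M G Z"
      using bounded_rvs_const bounded_rvs_subset_dual_space by (auto simp: dual_multipliers_def)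
    then show ?thesis using PInf by force
  next
    case MInf
    then show ?thesis using simple_conjugate_gt[of "\<lambda>\<omega>. - Z \<omega>"] by simp
  qed
  then show "\<exists>\<eta>\<in>dual_multipliers M G (rv_density M Q).
      simple_conjugate M T (\<lambda>\<omega>. - rv_density M Q \<omega>) = dual_penalty M F G H (rv_density M Q) \<eta>"
    using weak unfolding Z_def[symmetric] by (blast intro: antisym)
qed

text \<open>On a partition whose blocks carry constant density, \<open>X\<close> can be replaced by
  its conditional expectation. The latter is simple and so competes in the conjugate.\<close>

lemma partition_extension_ge:
  assumes X: "integrable M X" and Q: "Q \<in> simple_density_measures M"
  shows "ereal (\<integral>\<omega>. - X \<omega> \<partial>Q) - simple_conjugate M T (\<lambda>\<omega>. - rv_density M Q \<omega>)
    \<le> partition_extension M T X"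
proof -
  define Z where "Z = rv_density M Q"
  note Z = simple_density_measuresD[OF Q, folded Z_def]
  have [measurable]: "X \<in> borel_measurable M" "Z \<in> borel_measurable M"
    using X Z(1) by (auto simp: simple_rvs_def)
  obtain \<pi> z where \<pi>: "\<pi> \<in> finite_partitions M" and z: "AE \<omega> in M. Z \<omega> = step_rv \<pi> z \<omega>"
    using Z(1) by (rule simple_rvs_step)
  have [measurable]: "step_rv \<pi> z \<in> borel_measurable M" by (rule step_rv_measurable[OF \<pi>])
  let ?W = "partition_cond_exp M \<pi> X"
  have W: "?W \<in> simple_rvs M" by (rule partition_cond_exp_simple[OF \<pi>])
  then have [measurable]: "?W \<in> borel_measurable M" by (simp add: simple_rvs_def)
  obtain \<tau> where \<tau>: "T ?W = ereal \<tau>"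
    using W tnrm_finite simple_rvs_subset_bounded_rvs by blast
  define c where "c = (\<integral>\<omega>. - X \<omega> \<partial>Q)"
  have "c = - (\<integral>\<omega>. Z \<omega> * X \<omega> \<partial>M)" unfolding c_def using Z(4)[of "\<lambda>\<omega>. - X \<omega>"] by simp
  also have "(\<integral>\<omega>. Z \<omega> * X \<omega> \<partial>M) = (\<integral>\<omega>. step_rv \<pi> z \<omega> * X \<omega> \<partial>M)"
    using z by (intro integral_cong_AE) auto
  also have "\<dots> = (\<integral>\<omega>. step_rv \<pi> z \<omega> * ?W \<omega> \<partial>M)" by (rule partition_cond_exp_integral[OF \<pi> X, symmetric])
  also have "\<dots> = (\<integral>\<omega>. ?W \<omega> * Z \<omega> \<partial>M)"
    using z by (intro integral_cong_AE) auto
  finally have c: "c = (\<integral>\<omega>. ?W \<omega> * - Z \<omega> \<partial>M)" by simp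
  have "ereal c - T ?W \<le> simple_conjugate M T (\<lambda>\<omega>. - Z \<omega>)"
    unfolding c simple_conjugate_def using W by (rule SUP_upper)
  then have "ereal c - simple_conjugate M T (\<lambda>\<omega>. - Z \<omega>) \<le> T ?W"
    by (cases "simple_conjugate M T (\<lambda>\<omega>. - Z \<omega>)") (auto simp: \<tau>)
  also have "T ?W \<le> partition_extension M T X"
    unfolding partition_extension_def using \<pi> by (rule SUP_upper)
  finally show ?thesis by (simp add: Z_def c_def)
qed

text \<open>The density is a subgradient at the conditional expectation of \<open>T\<close> restricted to the step
  functions on \<open>\<pi>\<close>; because conditioning decreases \<open>T\<close>, it is a subgradient on all simple
  random variables.\<close>

lemma partition_extension_le:
  assumes X: "integrable M X" and \<pi>: "\<pi> \<in> finite_partitions M"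
  shows "\<exists>Q\<in>simple_density_measures M. T (partition_cond_exp M \<pi> X)
    \<le> ereal (\<integral>\<omega>. - X \<omega> \<partial>Q) - simple_conjugate M T (\<lambda>\<omega>. - rv_density M Q \<omega>)"
proof -
  define p where "p A = prob A" for A
  have p: "0 < p A" if "A \<in> \<pi>" for A using finite_partitionsD(5)[OF \<pi> that] by (simp add: p_def)
  have fin: "finite \<pi>" by (rule finite_partitionsD(1)[OF \<pi>])
  note step_b = step_rv_bounded[OF \<pi>]
  let ?Y = "partition_cond_exp M \<pi> X"
  obtain y where y: "\<And>\<omega>. \<omega> \<in> space M \<Longrightarrow> ?Y \<omega> = step_rv \<pi> y \<omega>"
    using partition_cond_exp_step[OF \<pi>] by blast
  have Y_b: "?Y \<in> bounded_rvs M"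
    using partition_cond_exp_simple[OF \<pi>] simple_rvs_subset_bounded_rvs by blast
  obtain \<tau> where \<tau>: "T ?Y = ereal \<tau>" using tnrm_finite[OF Y_b] by blast
  have Yw: "(\<lambda>\<omega>. s - (?Y \<omega> + step_rv \<pi> w \<omega>)) \<in> bounded_rvs M" for s w
    by (intro bounded_rvs_const_minus bounded_rvs_add Y_b step_b)
  \<comment> \<open>The increment of \<open>T\<close> from \<open>?Y\<close> to \<open>?Y\<close>
    plus a step variable, with the shift \<open>s\<close> as a witness: the infimum in
    \<open>T\<close> need not be attained, and convexity is inherited directly from the
    loss.\<close>
  define E where "E w r \<longleftrightarrow> (\<exists>s. loss (\<lambda>\<omega>. s - (?Y \<omega> + step_rv \<pi> w \<omega>)) \<le> ereal (\<tau> + r + s))" for w r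
  have T_eq: "T (\<lambda>\<omega>. ?Y \<omega> + step_rv \<pi> w \<omega>) = (INF s. loss (\<lambda>\<omega>. s - (?Y \<omega> + step_rv \<pi> w \<omega>)) - ereal s)" for w
    by (rule tnrm_eq)
  \<comment> \<open>Finiteness of \<open>T\<close> gives every \<open>w\<close> some cost
    \<open>r\<close>, hence both directions along each axis.\<close>
  have E_ex: "\<exists>r. E w r" for w
  proof -
    obtain \<sigma> where \<sigma>: "T (\<lambda>\<omega>. ?Y \<omega> + step_rv \<pi> w \<omega>) = ereal \<sigma>"
      using tnrm_finite[OF bounded_rvs_add[OF Y_b step_b]] by blast
    then have "(INF s. loss (\<lambda>\<omega>. s - (?Y \<omega> + step_rv \<pi> w \<omega>)) - ereal s) < ereal (\<sigma> + 1)"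
      by (simp flip: T_eq)
    then obtain s where s: "loss (\<lambda>\<omega>. s - (?Y \<omega> + step_rv \<pi> w \<omega>)) - ereal s < ereal (\<sigma> + 1)"
      by (auto simp: INF_less_iff)
    have "loss (\<lambda>\<omega>. s - (?Y \<omega> + step_rv \<pi> w \<omega>)) \<le> ereal (\<tau> + (\<sigma> + 1 - \<tau>) + s)"
      using s by (cases "loss (\<lambda>\<omega>. s - (?Y \<omega> + step_rv \<pi> w \<omega>))") auto
    then show ?thesis unfolding E_def by blast
  qed
  have E_mono: "E w' r" if "E w r" "\<And>A. A \<in> \<pi> \<Longrightarrow> w A \<le> w' A" for w w' r
  proof -
    from that(1) obtain s where s: "loss (\<lambda>\<omega>. s - (?Y \<omega> + step_rv \<pi> w \<omega>)) \<le> ereal (\<tau> + r + s)"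
      unfolding E_def by blast
    have "loss (\<lambda>\<omega>. s - (?Y \<omega> + step_rv \<pi> w' \<omega>)) \<le> loss (\<lambda>\<omega>. s - (?Y \<omega> + step_rv \<pi> w \<omega>))"
      using that(2) by (intro loss_mono Yw AE_I2) (auto elim!: block_exists[OF \<pi>] simp: step_rv_eq[OF \<pi>])
    also note s
    finally show ?thesis unfolding E_def by blast
  qed
  \<comment> \<open>Cash additivity: the shift \<open>s + m\<close> absorbs the added
    constant.\<close>
  have E_shift: "E (\<lambda>A. w A + m) (r - m)" if "E w r" for w r m
  proof -
    from that obtain s where s: "loss (\<lambda>\<omega>. s - (?Y \<omega> + step_rv \<pi> w \<omega>)) \<le> ereal (\<tau> + r + s)"
      unfolding E_def by blast
    have "loss (\<lambda>\<omega>. (s + m) - (?Y \<omega> + step_rv \<pi> (\<lambda>A. w A + m) \<omega>)) \<le> loss (\<lambda>\<omega>. s - (?Y \<omega> + step_rv \<pi> w \<omega>))"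
      by (intro loss_mono Yw AE_I2) (auto elim!: block_exists[OF \<pi>] simp: step_rv_eq[OF \<pi>])
    also note s
    also have "\<tau> + r + s = \<tau> + (r - m) + (s + m)" by simp
    finally show ?thesis unfolding E_def by blast
  qed
  have "\<exists>\<xi>. \<forall>w r. E w r \<longrightarrow> (\<Sum>A\<in>\<pi>. \<xi> A * w A) \<le> r"
  proof (rule convex_relation_supported[OF fin])
    fix w w' r r' t
    assume "E w r" "E w' r'" and t: "0 \<le> t" "t \<le> (1::real)"
    then obtain s s'
      where 1: "loss (\<lambda>\<omega>. s - (?Y \<omega> + step_rv \<pi> w \<omega>)) \<le> ereal (\<tau> + r + s)"
        and 2: "loss (\<lambda>\<omega>. s' - (?Y \<omega> + step_rv \<pi> w' \<omega>)) \<le> ereal (\<tau> + r' + s')"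
      unfolding E_def by blast
    define s'' where "s'' = (1 - t) * s + t * s'"
    have "(1 - t) * (s - (?Y \<omega> + step_rv \<pi> w \<omega>)) + t * (s' - (?Y \<omega> + step_rv \<pi> w' \<omega>))
        = s'' - (?Y \<omega> + step_rv \<pi> (\<lambda>A. (1 - t) * w A + t * w' A) \<omega>)" for \<omega>
      unfolding step_rv_lincomb s''_def by (simp add: algebra_simps)
    with loss_convex_le[OF Yw Yw t 1 2]
    have "loss (\<lambda>\<omega>. s'' - (?Y \<omega> + step_rv \<pi> (\<lambda>A. (1 - t) * w A + t * w' A) \<omega>))
        \<le> ereal ((1 - t) * (\<tau> + r + s) + t * (\<tau> + r' + s'))" by simp
    also have "(1 - t) * (\<tau> + r + s) + t * (\<tau> + r' + s') = \<tau> + ((1 - t) * r + t * r') + s''"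
      by (simp add: s''_def algebra_simps)
    finally show "E (\<lambda>A. (1 - t) * w A + t * w' A) ((1 - t) * r + t * r')"
      unfolding E_def by blast
  next
    fix w r assume "E w r" and w: "\<forall>A\<in>\<pi>. w A = 0"
    then obtain s where s: "loss (\<lambda>\<omega>. s - (?Y \<omega> + step_rv \<pi> w \<omega>)) \<le> ereal (\<tau> + r + s)"
      unfolding E_def by blast
    have zero: "step_rv \<pi> w = (\<lambda>_. 0)" using w by (simp add: step_rv_def fun_eq_iff)
    have "ereal \<tau> \<le> loss (\<lambda>\<omega>. s - ?Y \<omega>) - ereal s"
      unfolding \<tau>[symmetric] tnrm_eq by (rule INF_lower) simp
    then show "0 \<le> r" using s by (cases "loss (\<lambda>\<omega>. s - ?Y \<omega>)") (auto simp: zero)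
  next
    fix A assume "A \<in> \<pi>"
    obtain r where "E (\<lambda>B. if B = A then 1 else 0) r" using E_ex by blast
    then show "\<exists>w r. E w r \<and> 0 < w A \<and> (\<forall>B\<in>\<pi> - {A}. w B = 0)"
      by (intro exI[of _ "\<lambda>B. if B = A then 1 else 0"] exI[of _ r]) auto
    obtain r where "E (\<lambda>B. if B = A then - 1 else 0) r" using E_ex by blast
    then show "\<exists>w r. E w r \<and> w A < 0 \<and> (\<forall>B\<in>\<pi> - {A}. w B = 0)"
      by (intro exI[of _ "\<lambda>B. if B = A then - 1 else 0"] exI[of _ r]) auto
  qed
  then obtain \<xi> where \<xi>: "\<And>w r. E w r \<Longrightarrow> (\<Sum>A\<in>\<pi>. \<xi> A * w A) \<le> r" by blast
  obtain r\<^sub>0 where r\<^sub>0: "E (\<lambda>_. 0) r\<^sub>0" using E_ex by blast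
  \<comment> \<open>\<open>T\<close> decreases in its argument, hence the minus sign; division by
    the block probabilities makes \<open>z\<close> a density.\<close>
  define z where "z A = - \<xi> A / p A" for A
  have \<xi>_eq: "\<xi> A = - (p A * z A)" if "A \<in> \<pi>" for A using p[OF that] by (simp add: z_def)
  have z_nonneg: "0 \<le> z A" if A: "A \<in> \<pi>" for A
  proof (rule ccontr)
    assume "\<not> 0 \<le> z A"
    then have pos: "0 < \<xi> A" using p[OF A] by (simp add: \<xi>_eq[OF A] mult_pos_neg)
    define n where "n = (\<bar>r\<^sub>0\<bar> + 1) / \<xi> A"
    have "0 \<le> n" using pos by (simp add: n_def)
    then have "(\<Sum>B\<in>\<pi>. \<xi> B * (if B = A then n else 0)) \<le> r\<^sub>0"
      by (intro \<xi> E_mono[OF r\<^sub>0]) auto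
    moreover have "(\<Sum>B\<in>\<pi>. \<xi> B * (if B = A then n else 0)) = \<xi> A * n"
      using fin A by (simp add: if_distrib cong: if_cong)
    ultimately show False using pos by (simp add: n_def)
  qed
  define \<sigma> where "\<sigma> = (\<Sum>A\<in>\<pi>. p A * z A)"
  \<comment> \<open>Constants \<open>m\<close> of either sign and any size are allowed, which forces
    \<open>\<sigma> = 1\<close>.\<close>
  have \<sigma>_le: "m * (1 - \<sigma>) \<le> r\<^sub>0" for m
  proof -
    have "(\<Sum>A\<in>\<pi>. \<xi> A * (0 + m)) \<le> r\<^sub>0 - m" by (rule \<xi>[OF E_shift[OF r\<^sub>0]])
    moreover have "(\<Sum>A\<in>\<pi>. \<xi> A * (0 + m)) = - (\<sigma> * m)"
      unfolding \<sigma>_def sum_distrib_right sum_negf[symmetric] by (intro sum.cong) (simp_all add: \<xi>_eq)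
    ultimately show ?thesis by (simp add: algebra_simps)
  qed
  have \<sigma>: "\<sigma> = 1"
  proof (rule ccontr)
    assume "\<sigma> \<noteq> 1"
    then show False using \<sigma>_le[of "(r\<^sub>0 + 1) / (1 - \<sigma>)"] by simp
  qed
  obtain Q where Q: "Q \<in> simple_density_measures M" and z: "AE \<omega> in M. rv_density M Q \<omega> = step_rv \<pi> z \<omega>"
    using step_rv_density[OF \<pi>, of z] z_nonneg \<sigma> unfolding \<sigma>_def p_def by blast
  note density = simple_density_measuresD[OF Q]
  have meas[measurable]: "rv_density M Q \<in> borel_measurable M" "X \<in> borel_measurable M"
      "step_rv \<pi> v \<in> borel_measurable M" for v
    using density(1) X step_rv_measurable[OF \<pi>] by (auto simp: simple_rvs_def)
  have step_integral: "(\<integral>\<omega>. rv_density M Q \<omega> * V \<omega> \<partial>M) = (\<Sum>A\<in>\<pi>. p A * z A * v A)"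
    if V: "integrable M V" and v: "\<And>\<omega>. \<omega> \<in> space M \<Longrightarrow> partition_cond_exp M \<pi> V \<omega> = step_rv \<pi> v \<omega>" for V v
  proof -
    have [measurable]: "V \<in> borel_measurable M" using V by auto
    have "(\<integral>\<omega>. rv_density M Q \<omega> * V \<omega> \<partial>M) = (\<integral>\<omega>. step_rv \<pi> z \<omega> * V \<omega> \<partial>M)"
      using z by (intro integral_cong_AE) auto
    also have "\<dots> = (\<integral>\<omega>. step_rv \<pi> z \<omega> * partition_cond_exp M \<pi> V \<omega> \<partial>M)"
      by (rule partition_cond_exp_integral[OF \<pi> V, symmetric])
    also have "\<dots> = (\<integral>\<omega>. step_rv \<pi> z \<omega> * step_rv \<pi> v \<omega> \<partial>M)"
      by (intro Bochner_Integration.integral_cong) (auto simp: v)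
    also have "\<dots> = (\<Sum>A\<in>\<pi>. p A * z A * v A)" unfolding p_def by (rule integral_step_rv_mult[OF \<pi>])
    finally show ?thesis .
  qed
  define c where "c = (\<Sum>A\<in>\<pi>. p A * z A * y A)"
  have X_int: "(\<integral>\<omega>. - X \<omega> \<partial>Q) = - c"
    using density(4)[of "\<lambda>\<omega>. - X \<omega>"] step_integral[OF X y] by (simp add: c_def)
  have "simple_conjugate M T (\<lambda>\<omega>. - rv_density M Q \<omega>) \<le> ereal (- c - \<tau>)"
    unfolding simple_conjugate_def
  proof (rule SUP_least)
    fix V assume "V \<in> simple_rvs M"
    then have V_b: "V \<in> bounded_rvs M" using simple_rvs_subset_bounded_rvs by auto
    then have V: "integrable M V" by (rule bounded_rvs_integrable)
    let ?V = "partition_cond_exp M \<pi> V"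
    obtain v where v: "\<And>\<omega>. \<omega> \<in> space M \<Longrightarrow> ?V \<omega> = step_rv \<pi> v \<omega>"
      using partition_cond_exp_step[OF \<pi>] by blast
    define d where "d = (\<Sum>A\<in>\<pi>. p A * z A * v A)"
    \<comment> \<open>The subgradient inequality at \<open>V\<close>, proved for each shift before
      the infimum is taken: \<open>c - d\<close> is the value of the supporting functional at the
      increment \<open>v - y\<close>.\<close>
    have "ereal (\<tau> + c - d) \<le> loss (\<lambda>\<omega>. s - V \<omega>) - ereal s" for s
    proof (cases "loss (\<lambda>\<omega>. s - V \<omega>)")
      case (real l)
      have sV: "(\<lambda>\<omega>. s - V \<omega>) \<in> bounded_rvs M" by (rule bounded_rvs_const_minus[OF V_b])
      interpret finite_measure_subalgebra M "sigma (space M) \<pi>"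
        by unfold_locales (rule subalgebra_partition[OF \<pi>])
      have const: "integrable M (\<lambda>_. s)" by simp
      \<comment> \<open>Conditioned on \<pi>, \<open>s - V\<close> has coordinates
        \<open>s - v A\<close>; this is \<open>s\<close> minus the perturbation of \<open>?Y\<close>
        by \<open>v - y\<close>, so the relation \<open>E\<close> applies.\<close>
      have V_step: "AE \<omega> in M. s - (?Y \<omega> + step_rv \<pi> (\<lambda>A. v A - y A) \<omega>) \<le> partition_cond_exp M \<pi> (\<lambda>\<omega>. s - V \<omega>) \<omega>"
        using real_cond_exp_diff[OF const V] real_cond_exp_F_meas[OF const borel_measurable_const] AE_space
        unfolding partition_cond_exp_def[symmetric]
      proof eventually_elim
        case (elim \<omega>)
        then obtain A where A: "A \<in> \<pi>" "\<omega> \<in> A" using block_exists[OF \<pi>] by blast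
        then show ?case using elim by (simp add: y v step_rv_eq[OF \<pi> A])
      qed
      have "partition_cond_exp M \<pi> (\<lambda>\<omega>. s - V \<omega>) \<in> bounded_rvs M"
        using partition_cond_exp_simple[OF \<pi>] simple_rvs_subset_bounded_rvs by blast
      then have "loss (\<lambda>\<omega>. s - (?Y \<omega> + step_rv \<pi> (\<lambda>A. v A - y A) \<omega>))
          \<le> loss (partition_cond_exp M \<pi> (\<lambda>\<omega>. s - V \<omega>))"
        by (rule loss_mono[OF Yw _ V_step])
      also have "\<dots> \<le> loss (\<lambda>\<omega>. s - V \<omega>)" by (rule loss_cond_exp[OF \<pi> sV])
      finally have "E (\<lambda>A. v A - y A) (l - \<tau> - s)" unfolding E_def real by (intro exI[of _ s]) simp
      then have "(\<Sum>A\<in>\<pi>. \<xi> A * (v A - y A)) \<le> l - \<tau> - s" by (rule \<xi>)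
      moreover have "(\<Sum>A\<in>\<pi>. \<xi> A * (v A - y A)) = c - d"
        unfolding c_def d_def sum_subtractf[symmetric] by (intro sum.cong) (simp_all add: \<xi>_eq algebra_simps)
      ultimately show ?thesis using real by simp
    next
      case MInf
      then show ?thesis using F_nrm_gt by (simp add: loss_def)
    qed simp
    then have "ereal (\<tau> + c - d) \<le> T V" unfolding tnrm_eq by (rule INF_greatest)
    moreover have "(\<integral>\<omega>. V \<omega> * - rv_density M Q \<omega> \<partial>M) = - d"
      using step_integral[OF V v] by (simp add: d_def mult.commute)
    ultimately show "ereal (\<integral>\<omega>. V \<omega> * - rv_density M Q \<omega> \<partial>M) - T V \<le> ereal (- c - \<tau>)"
      by (cases "T V") auto
  qed
  then have "T ?Y \<le> ereal (\<integral>\<omega>. - X \<omega> \<partial>Q) - simple_conjugate M T (\<lambda>\<omega>. - rv_density M Q \<omega>)"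
    unfolding X_int \<tau> by (cases "simple_conjugate M T (\<lambda>\<omega>. - rv_density M Q \<omega>)") auto
  with Q show ?thesis by blast
qed

end

theorem corollary13:
  fixes M :: "'a measure"
    and F G :: "real \<Rightarrow> ereal"
    and H :: "real \<Rightarrow> real"
  assumes "prob_space M" and "nonatomic M"
    and F_gt_MInf: "\<forall>x\<ge>0. - \<infinity> < F x"
    and F_left_cont: "left_continuous_pos F"
    and F_increasing: "\<forall>x y. 0 \<le> x \<and> x \<le> y \<longrightarrow> F x \<le> F y"
    and F_convex: "ereal_convex_on {0..} F"
    and F_proper: "\<exists>x\<ge>0. F x \<noteq> \<infinity>"
    and F_lim: "(F \<longlongrightarrow> \<infinity>) at_top"
    and G_orlicz: "orlicz_function G"
    and G_real: "\<forall>x\<ge>0. G x < \<infinity>"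
    and H_nonneg: "\<forall>x. 0 \<le> H x"
    and H_increasing: "mono H"
    and H_convex: "convex_on UNIV H"
    and H_lim: "filterlim H at_top at_top"
    and FGH1: "\<exists>s. \<exists>\<epsilon>>0. F ((H s + \<epsilon>) / inverse_at_one G) < \<infinity>"
    and FGH2: "((\<lambda>s. F (H s) - ereal (inverse_at_one G * s)) \<longlongrightarrow> \<infinity>) at_top"
  shows "(\<forall>X. integrable M X \<longrightarrow>
           partition_extension M (tnrm M F G H) X =
             (SUP Q\<in>simple_density_measures M.
                ereal (\<integral>\<omega>. - X \<omega> \<partial>Q)
                - simple_conjugate M (tnrm M F G H) (\<lambda>\<omega>. - rv_density M Q \<omega>))) \<and>
         (\<forall>Q\<in>simple_density_measures M.
           (\<exists>\<eta>\<in>dual_multipliers M G (rv_density M Q).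
              simple_conjugate M (tnrm M F G H) (\<lambda>\<omega>. - rv_density M Q \<omega>)
                = dual_penalty M F G H (rv_density M Q) \<eta>) \<and>
           (\<forall>\<eta>\<in>dual_multipliers M G (rv_density M Q).
              simple_conjugate M (tnrm M F G H) (\<lambda>\<omega>. - rv_density M Q \<omega>)
                \<le> dual_penalty M F G H (rv_density M Q) \<eta>))"
proof -
  interpret prob_space M by fact
  interpret tnrm_setting M G F H
    by unfold_locales (fact G_orlicz G_real F_gt_MInf F_increasing F_convex H_nonneg H_increasing
      H_convex H_lim FGH1 FGH2)+
  show ?thesis
  proof (intro conjI allI impI ballI)
    fix X :: "'a \<Rightarrow> real" assume X: "integrable M X"
    show "partition_extension M T X = (SUP Q\<in>simple_density_measures M.
        ereal (\<integral>\<omega>. - X \<omega> \<partial>Q) - simple_conjugate M T (\<lambda>\<omega>. - rv_density M Q \<omega>))"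
    proof (rule antisym)
      show "partition_extension M T X \<le> (SUP Q\<in>simple_density_measures M.
          ereal (\<integral>\<omega>. - X \<omega> \<partial>Q) - simple_conjugate M T (\<lambda>\<omega>. - rv_density M Q \<omega>))"
        \<comment> \<open>Each partition is matched with a single measure, since the subgradient at
          the conditional expectation is exact and no approximation is involved.\<close>
        unfolding partition_extension_def by (rule SUP_mono) (rule partition_extension_le[OF X])
      show "(SUP Q\<in>simple_density_measures M.
          ereal (\<integral>\<omega>. - X \<omega> \<partial>Q) - simple_conjugate M T (\<lambda>\<omega>. - rv_density M Q \<omega>))
          \<le> partition_extension M T X"
        by (rule SUP_least) (rule partition_extension_ge[OF X])
    qed
  qed (rule penalty_attained, assumption+)+
qed

end
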